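(* Let $R:\widehat{\mathbb{C}}\to\widehat{\mathbb{C}}$ be a rational map of degree at least $2$, and let $\Sigma(R)$ be the group of holomorphic isometries $\sigma$ of $\widehat{\mathbb{C}}$ with $\sigma(J(R))=J(R)$. Then $\Sigma(R)$ is isomorphic to one of the following groups: (i) the trivial group; (ii) a group of roots of unity, i.e. $\{z\mapsto \mu z : \mu^k=1\}$ for some integer $k$; (iii) a dihedral group generated by a root of unity $z\mapsto e^{2\pi i/k}z$ and the inversion $z\mapsto 1/z$; (iv) the group of orientation-preserving symmetries of a regular tetrahedron, octahedron or icosahedron; (v) $\mathrm{S}[\mathrm{O}(1)\times\mathrm{O}(2)]$, i.e. the group of isometries of the form $z\mapsto e^{i\theta}z$ and $z\mapsto e^{i\theta}/z$ for $\theta\in[0,2\pi)$; (vi) the group of all holomorphic isometries of the Riemann sphere.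
   Context: $\widehat{\mathbb{C}}=\mathbb{C}\cup\{\infty\}$ is the Riemann sphere. For a rational map $R$, $J(R)$ denotes its Julia set (the complement of the Fatou set $F(R)$, the set of points having a neighbourhood on which the iterates of $R$ form a normal family). The group of holomorphic isometries of $\widehat{\mathbb{C}}$ is $$\mathcal{I}(\widehat{\mathbb{C}})=\left\{z\mapsto\frac{az-\bar b}{bz+\bar a} : a,b\in\mathbb{C},\ |a|^2+|b|^2=1\right\},$$ which is isomorphic as a Lie group to $\mathrm{SO}(3)$. The symmetry group of $J(R)$ is $\Sigma(R)=\{\sigma\in\mathcal{I}(\widehat{\mathbb{C}}) : \sigma(J(R))=J(R)\}$.
   Formalization: In (ii) the integer k may be 0, which then means the group of all rotations z ↦ e^{iθ}z; without this group the list is incomplete, since R(z) = z²/2 has Julia set |z| = 2, whose symmetry group is exactly these rotations. *)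

theory Defs
  imports
    "HOL-Analysis.Analysis"
    "HOL-Computational_Algebra.Polynomial"
    "HOL-Algebra.Bij"
    "HOL-Algebra.Generated_Groups"
begin

section \<open>The Riemann sphere\<close>

datatype riemann_sphere = Finite complex | Infinity

primrec stereo :: "riemann_sphere \<Rightarrow> complex \<times> real" where
  "stereo (Finite z) =
     ((2 / (1 + (cmod z)\<^sup>2)) *\<^sub>R z, ((cmod z)\<^sup>2 - 1) / ((cmod z)\<^sup>2 + 1))"
| "stereo Infinity = (0, 1)"

lemma stereo_inject: "stereo x = stereo y \<longleftrightarrow> x = y"
proof -
  have pos: "1 + (cmod z)\<^sup>2 > 0" for z
    by (simp add: add_pos_nonneg)
  have snd_eq: "snd (stereo (Finite z)) = 1 - 2 / (1 + (cmod z)\<^sup>2)" for z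
    using pos[of z] by (simp add: field_simps)
  have ne: "stereo (Finite z) \<noteq> stereo Infinity" for z
  proof
    assume "stereo (Finite z) = stereo Infinity"
    then have "snd (stereo (Finite z)) = 1" by simp
    then show False using snd_eq[of z] pos[of z] by simp
  qed
  have inj: "z = w" if "stereo (Finite z) = stereo (Finite w)" for z w
  proof -
    have "snd (stereo (Finite z)) = snd (stereo (Finite w))" using that by simp
    then have c: "2 / (1 + (cmod z)\<^sup>2) = 2 / (1 + (cmod w)\<^sup>2)"
      unfolding snd_eq by simp
    have "fst (stereo (Finite z)) = fst (stereo (Finite w))" using that by simp
    then have "(2 / (1 + (cmod z)\<^sup>2)) *\<^sub>R z = (2 / (1 + (cmod z)\<^sup>2)) *\<^sub>R w"
      using c by simp
    moreover have "2 / (1 + (cmod z)\<^sup>2) \<noteq> 0" using pos[of z] by simp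
    ultimately show ?thesis by (simp only: scaleR_cancel_left) simp
  qed
  show ?thesis
    using ne ne[symmetric] inj by (cases x; cases y) blast+
qed

text \<open>
  The metric is the chordal one, induced by stereographic projection onto the unit sphere
  of \<open>\<complex> \<times> \<real>\<close>; the familiar formulas are proved below.
\<close>

instantiation riemann_sphere :: metric_space
begin

definition dist_riemann_sphere :: "riemann_sphere \<Rightarrow> riemann_sphere \<Rightarrow> real" where
  "dist_riemann_sphere x y = dist (stereo x) (stereo y)"

definition uniformity_riemann_sphere :: "(riemann_sphere \<times> riemann_sphere) filter" where
  "uniformity_riemann_sphere = (INF e\<in>{0<..}. principal {(x, y). dist x y < e})"

definition open_riemann_sphere :: "riemann_sphere set \<Rightarrow> bool" where
  "open_riemann_sphere U \<longleftrightarrow>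
     (\<forall>x\<in>U. \<forall>\<^sub>F (x', y) in uniformity. x' = x \<longrightarrow> y \<in> U)"

instance
proof
  fix x y z :: riemann_sphere
  show "dist x y = 0 \<longleftrightarrow> x = y"
    by (simp add: dist_riemann_sphere_def stereo_inject)
  show "dist x y \<le> dist x z + dist y z"
    by (simp add: dist_riemann_sphere_def dist_triangle2)
qed (simp_all only: uniformity_riemann_sphere_def open_riemann_sphere_def)

end

lemma dist_Finite_Infinity: "dist (Finite z) Infinity = 2 / sqrt (1 + (cmod z)\<^sup>2)"
proof -
  define A where "A = 1 + (cmod z)\<^sup>2"
  have A: "A > 0" unfolding A_def by (simp add: add_pos_nonneg)
  have N: "(cmod z)\<^sup>2 = A - 1" by (simp add: A_def)
  have "dist (Finite z) Infinity = sqrt ((2 / A)\<^sup>2 * (A - 1) + ((A - 2) / A - 1)\<^sup>2)"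
    by (simp add: dist_riemann_sphere_def dist_prod_def dist_norm power_mult_distrib
        N power_divide)
  also have "(2 / A)\<^sup>2 * (A - 1) + ((A - 2) / A - 1)\<^sup>2 = 4 / A"
    using A by (simp add: field_simps power2_eq_square)
  also have "sqrt (4 / A) = 2 / sqrt A"
    by (simp add: real_sqrt_divide)
  finally show ?thesis by (simp add: A_def)
qed

lemma dist_Finite_Finite:
  "dist (Finite z) (Finite w) =
     2 * cmod (z - w) / (sqrt (1 + (cmod z)\<^sup>2) * sqrt (1 + (cmod w)\<^sup>2))"
proof -
  define A B where "A = 1 + (cmod z)\<^sup>2" and "B = 1 + (cmod w)\<^sup>2"
  have A: "A > 0" and B: "B > 0" unfolding A_def B_def by (simp_all add: add_pos_nonneg)
  have N: "z \<bullet> z = A - 1" "w \<bullet> w = B - 1" by (simp_all add: A_def B_def power2_norm_eq_inner)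
  have M: "(cmod z)\<^sup>2 = A - 1" "(cmod w)\<^sup>2 = B - 1" by (simp_all add: A_def B_def)
  have expand: "(cmod (c *\<^sub>R z - e *\<^sub>R w))\<^sup>2 =
      c\<^sup>2 * (A - 1) - 2 * c * e * (z \<bullet> w) + e\<^sup>2 * (B - 1)" for c e :: real
    unfolding power2_norm_eq_inner
    by (simp add: inner_diff_left inner_diff_right inner_commute N power2_eq_square)
  have "(dist (Finite z) (Finite w))\<^sup>2 =
      (cmod ((2 / A) *\<^sub>R z - (2 / B) *\<^sub>R w))\<^sup>2 + ((A - 2) / A - (B - 2) / B)\<^sup>2"
    by (simp add: dist_riemann_sphere_def dist_prod_def dist_norm M)
  also have "(cmod ((2 / A) *\<^sub>R z - (2 / B) *\<^sub>R w))\<^sup>2 =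
      (2 / A)\<^sup>2 * (A - 1) - 2 * (2 / A) * (2 / B) * (z \<bullet> w) + (2 / B)\<^sup>2 * (B - 1)"
    by (rule expand)
  also have "\<dots> + ((A - 2) / A - (B - 2) / B)\<^sup>2 = 4 * (A - 1 - 2 * (z \<bullet> w) + (B - 1)) / (A * B)"
    using A B by (simp add: divide_simps) algebra
  also have "A - 1 - 2 * (z \<bullet> w) + (B - 1) = (cmod (z - w))\<^sup>2"
    unfolding power2_norm_eq_inner
    by (simp add: inner_diff_left inner_diff_right inner_commute N)
  also have "4 * (cmod (z - w))\<^sup>2 / (A * B) = (2 * cmod (z - w) / (sqrt A * sqrt B))\<^sup>2"
    using A B by (simp add: power_divide power_mult_distrib)
  finally show ?thesis
    using A B by (simp add: power2_eq_iff_nonneg A_def B_def)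
qed

section \<open>Rational maps and their Julia sets\<close>

text \<open>The point with homogeneous coordinates \<open>[z : w]\<close>, for \<open>(z, w) \<noteq> (0, 0)\<close>.\<close>

definition sphere_quot :: "complex \<Rightarrow> complex \<Rightarrow> riemann_sphere" where
  "sphere_quot z w = (if w = 0 then Infinity else Finite (z / w))"

text \<open>
  The degree of \<open>p / q\<close> in lowest terms is \<open>n = max (degree p) (degree q)\<close>, and the value at
  infinity is the quotient of the coefficients of \<open>X\<^sup>n\<close>.
\<close>

primrec rational_fun :: "complex poly \<Rightarrow> complex poly \<Rightarrow> riemann_sphere \<Rightarrow> riemann_sphere" where
  "rational_fun p q (Finite z) = sphere_quot (poly p z) (poly q z)"
| "rational_fun p q Infinity =
     (let n = max (degree p) (degree q) in sphere_quot (coeff p n) (coeff q n))"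

definition rational_map_of_degree :: "(riemann_sphere \<Rightarrow> riemann_sphere) \<Rightarrow> nat \<Rightarrow> bool" where
  "rational_map_of_degree R d \<longleftrightarrow>
     (\<exists>p q. q \<noteq> 0 \<and> coprime p q \<and> d = max (degree p) (degree q) \<and> R = rational_fun p q)"

definition normal_family_on ::
  "'a::metric_space set \<Rightarrow> ('a \<Rightarrow> 'b::metric_space) set \<Rightarrow> bool" where
  "normal_family_on U \<F> \<longleftrightarrow>
     (\<forall>f::nat \<Rightarrow> 'a \<Rightarrow> 'b. range f \<subseteq> \<F> \<longrightarrow>
        (\<exists>r g. strict_mono r \<and>
           (\<forall>K. compact K \<and> K \<subseteq> U \<longrightarrow> uniform_limit K (f \<circ> r) g sequentially)))"

definition fatou_set :: "(riemann_sphere \<Rightarrow> riemann_sphere) \<Rightarrow> riemann_sphere set" where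
  "fatou_set R = {z. \<exists>U. open U \<and> z \<in> U \<and> normal_family_on U (range (\<lambda>n. R ^^ n))}"

definition julia_set :: "(riemann_sphere \<Rightarrow> riemann_sphere) \<Rightarrow> riemann_sphere set" where
  "julia_set R = - fatou_set R"


section \<open>Isometries and symmetries\<close>

primrec moebius ::
  "complex \<Rightarrow> complex \<Rightarrow> complex \<Rightarrow> complex \<Rightarrow> riemann_sphere \<Rightarrow> riemann_sphere" where
  "moebius a b c d (Finite z) = sphere_quot (a * z + b) (c * z + d)"
| "moebius a b c d Infinity = sphere_quot a c"

definition sphere_isometries :: "(riemann_sphere \<Rightarrow> riemann_sphere) set" where
  "sphere_isometries =
     {moebius a (- cnj b) b (cnj a) | a b. (cmod a)\<^sup>2 + (cmod b)\<^sup>2 = 1}"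

definition julia_symmetries ::
  "(riemann_sphere \<Rightarrow> riemann_sphere) \<Rightarrow> (riemann_sphere \<Rightarrow> riemann_sphere) set" where
  "julia_symmetries R = {\<sigma> \<in> sphere_isometries. \<sigma> ` julia_set R = julia_set R}"

text \<open>A set of bijections, regarded as a group under composition.\<close>

definition map_group :: "('a \<Rightarrow> 'a) set \<Rightarrow> ('a \<Rightarrow> 'a) monoid" where
  "map_group S = (BijGroup UNIV)\<lparr>carrier := S\<rparr>"


section \<open>The groups of the list\<close>

text \<open>
  The group \<open>{z \<mapsto> \<mu> z : \<mu>\<^sup>k = 1}\<close>, as a group of isometries, for an arbitrary integer \<open>k\<close>.
  For \<open>k \<noteq> 0\<close> the equation forces \<open>\<bar>\<mu>\<bar> = 1\<close>, so membership in \<open>sphere_isometries\<close> is automatic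
  and the group is cyclic of order \<open>\<bar>k\<bar>\<close>. For \<open>k = 0\<close> the equation is void and the group consists of
  all rotations \<open>z \<mapsto> e\<^sup>i\<^sup>\<theta> z\<close>. That case does occur: the Julia set of \<open>z \<mapsto> z\<^sup>2 / 2\<close> is
  the circle of radius \<open>2\<close>, whose symmetries are exactly those rotations.
\<close>

definition roots_of_unity_maps :: "int \<Rightarrow> (riemann_sphere \<Rightarrow> riemann_sphere) set" where
  "roots_of_unity_maps k =
     {\<sigma> \<in> sphere_isometries. \<exists>\<mu>. \<mu> powi k = 1 \<and> \<sigma> = moebius \<mu> 0 0 1}"

definition dihedral_maps :: "nat \<Rightarrow> (riemann_sphere \<Rightarrow> riemann_sphere) set" where
  "dihedral_maps k =
     generate (BijGroup UNIV) {moebius (cis (2 * pi / real k)) 0 0 1, moebius 0 1 1 0}"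

definition O1_O2_maps :: "(riemann_sphere \<Rightarrow> riemann_sphere) set" where
  "O1_O2_maps =
     {moebius (cis \<theta>) 0 0 1 | \<theta>. \<theta> \<in> {0..<2 * pi}} \<union>
     {moebius 0 (cis \<theta>) 1 0 | \<theta>. \<theta> \<in> {0..<2 * pi}}"

text \<open>
  For a solid with centroid \<open>0\<close>, every isometry of \<open>\<real>\<^sup>3\<close> preserving the solid fixes \<open>0\<close> and is
  therefore linear.
\<close>

definition rotational_symmetries :: "(real ^ 3) set \<Rightarrow> (real ^ 3 \<Rightarrow> real ^ 3) set" where
  "rotational_symmetries P =
     {f. orthogonal_transformation f \<and> det (matrix f) = 1 \<and> f ` P = P}"

definition regular_tetrahedron :: "(real ^ 3) set" where
  "regular_tetrahedron =
     convex hull {vector [1, 1, 1], vector [1, -1, -1], vector [-1, 1, -1], vector [-1, -1, 1]}"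

definition regular_octahedron :: "(real ^ 3) set" where
  "regular_octahedron =
     convex hull (\<Union>s\<in>{1, -1}. {vector [s, 0, 0], vector [0, s, 0], vector [0, 0, s]})"

definition regular_icosahedron :: "(real ^ 3) set" where
  "regular_icosahedron =
     (let \<phi> = (1 + sqrt 5) / 2 in
      convex hull (\<Union>s\<in>{1, -1}. \<Union>t\<in>{\<phi>, - \<phi>}.
        {vector [0, s, t], vector [s, t, 0], vector [t, 0, s]}))"

end

theory Submission
  imports Defs
begin

text \<open>
  Stereographic projection identifies the holomorphic isometries with the rotations of \<open>\<real>\<^sup>3\<close>.
  Since the Julia set is closed, its symmetries form a closed group \<open>G\<close> of rotations.

  If \<open>G\<close> is infinite, it contains arbitrarily small rotations, hence in the limit all rotations about
  some axis; then either \<open>G\<close> preserves that axis, or the orbit of the axis is open and closed in the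
  sphere and \<open>G\<close> is the full rotation group.

  If \<open>G\<close> is finite, counting the fixed points of its nontrivial elements shows that either some axis is
  preserved or there is an orbit of \<open>4\<close>, \<open>6\<close> or \<open>12\<close> points whose stabilizers have order \<open>3\<close>, \<open>4\<close> or
  \<open>5\<close>. The inner products between the points of such an orbit can be computed, and they identify it with
  the vertices of a regular tetrahedron, octahedron or icosahedron, on which \<open>G\<close> acts transitively on
  the pairs of adjacent vertices.
\<close>

section \<open>Rotations of three-space\<close>

text \<open>Matrices on \<open>real^3\<close> bring in cross products: a rotation is determined by
  its values on two independent vectors, and a nontrivial one fixes exactly two unit vectors. The
  result asserts isomorphism, not conjugacy inside a fixed frame. Hence an invariant axis may be
  moved to \<open>e3\<close>, and an orbit may be matched with the coordinates of a solid by an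
  orthogonal matrix of either determinant. The sizes 4, 6, 12 come from the orbit equation: for a
  group of order N whose orbits of fixed points have stabilizers of orders n_i, the sum of all 1 -
  1/n_i is 2 - 2/N. Three orbits leave (2,2,n), (2,3,3), (2,3,4) and (2,3,5). The orbit with the
  largest stabilizer is used because it spans a solid with triangular faces, unlike the cube or the
  dodecahedron: three mutually adjacent vertices form an equiangular basis that fixes all
  coordinates. An orbit carries no edges, so adjacency must be recovered from inner products: the
  neighbours of a vertex are one orbit of its stabilizer.\<close>

lemmas vec3_simps = vec_eq_iff forall_3 sum_3 vector_3 matrix_vector_mult_def matrix_matrix_mult_def
  transpose_def mat_def axis_def

declare transpose_matrix_vector [simp del]

lemma rotation_matrix_mult: "rotation_matrix A \<Longrightarrow> rotation_matrix B \<Longrightarrow> rotation_matrix (A ** B)"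
  for A B :: "real^'n^'n"
  by (simp add: rotation_matrix_def det_mul orthogonal_matrix_mul)

lemma rotation_matrix_transpose: "rotation_matrix (A :: real^'n^'n) \<Longrightarrow> rotation_matrix (transpose A)"
  by (simp add: rotation_matrix_def)

lemma rotation_matrix_mat_1: "rotation_matrix (mat 1 :: real^'n^'n)"
  by (simp add: rotation_matrix_def orthogonal_matrix_id)

lemma rotation_matrix_inverse:
  assumes "rotation_matrix (A :: real^'n^'n)"
  shows "A ** transpose A = mat 1" "transpose A ** A = mat 1"
    "A *v (transpose A *v x) = x" "transpose A *v (A *v x) = x"
    "A ** (transpose A ** B) = B" "transpose A ** (A ** B) = B"
proof -
  show *: "A ** transpose A = mat 1" "transpose A ** A = mat 1"
    using assms by (auto simp: rotation_matrix_def orthogonal_matrix_def)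
  show "A *v (transpose A *v x) = x" "transpose A *v (A *v x) = x"
    by (simp_all add: matrix_vector_mul_assoc *)
  show "A ** (transpose A ** B) = B" "transpose A ** (A ** B) = B"
    by (simp_all add: matrix_mul_assoc *)
qed

lemma rotation_matrix_inner:
  assumes "rotation_matrix (A :: real^'n^'n)"
  shows "(A *v x) \<bullet> (A *v y) = x \<bullet> y"
  using assms rotation_matrix_inverse[OF assms]
  by (metis dot_lmul_matrix vector_transpose_matrix)

lemma rotation_matrix_norm:
  assumes "rotation_matrix (A :: real^'n^'n)"
  shows "norm (A *v x) = norm x"
  by (simp add: norm_eq_sqrt_inner rotation_matrix_inner[OF assms])

lemma inner_transpose: "(transpose A *v x) \<bullet> y = x \<bullet> (A *v y)" for A :: "real^'n^'m"
  by (simp add: dot_lmul_matrix transpose_matrix_vector)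

text \<open>Rotations respect cross products, so agreement on p and q extends to r = p x q. Every
  row of A - B is then orthogonal to the basis p, q, r.\<close>

lemma rotation_matrix_eqI:
  fixes A B :: "real^3^3"
  assumes A: "rotation_matrix A" and B: "rotation_matrix B"
    and p: "A *v p = B *v p" and q: "A *v q = B *v q" and pq: "cross3 p q \<noteq> 0"
  shows "A = B"
proof -
  define r where "r = cross3 p q"
  have r: "A *v r = B *v r"
    unfolding r_def by (metis A B cross_rotation_matrix p q)
  have "(A - B) $ i = 0" for i
  proof -
    define d where "d = (A - B) $ i"
    have D: "d \<bullet> x = 0" if "A *v x = B *v x" for x
    proof -
      have "((A - B) *v x) $ i = 0" using that by (simp add: matrix_vector_mult_diff_rdistrib)
      then show ?thesis by (simp add: d_def matrix_vector_mult_def inner_vec_def)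
    qed
    \<comment> \<open>The row d is thus both parallel and orthogonal to r, which forces d = 0
      because r is nonzero.\<close>
    have "cross3 d r = (d \<bullet> q) *\<^sub>R p - (d \<bullet> p) *\<^sub>R q"
      unfolding r_def by (rule Lagrange)
    also have "\<dots> = 0" using D[OF p] D[OF q] by simp
    finally have "cross3 d r = 0" .
    with D[OF r] pq show ?thesis
      using norm_and_cross_eq_0[of d r] unfolding d_def[symmetric] r_def by auto
  qed
  then show ?thesis by (simp add: vec_eq_iff)
qed

lemma unit_eq_or_minus:
  fixes p q :: "'a::real_inner"
  assumes "norm p = 1" "norm q = 1"
  shows "p \<bullet> q = 1 \<Longrightarrow> p = q" "p \<bullet> q = -1 \<Longrightarrow> p = - q"
proof -
  have pp: "p \<bullet> p = 1" "q \<bullet> q = 1" using assms by (simp_all add: dot_square_norm)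
  show "p = q" if "p \<bullet> q = 1"
  proof -
    have "(p - q) \<bullet> (p - q) = 0"
      using that by (simp add: inner_diff_left inner_diff_right inner_commute pp)
    then show ?thesis by simp
  qed
  show "p = - q" if "p \<bullet> q = -1"
  proof -
    have "(p + q) \<bullet> (p + q) = 0"
      using that by (simp add: inner_add_left inner_add_right inner_commute pp)
    then show ?thesis by (simp add: eq_neg_iff_add_eq_0)
  qed
qed

lemma cross3_unit_nonzero:
  assumes "norm p = 1" "norm q = 1" "q \<noteq> p" "q \<noteq> - p"
  shows "cross3 p q \<noteq> 0"
proof
  assume "cross3 p q = 0"
  then have "(p \<bullet> q)\<^sup>2 = 1" using norm_cross_dot[of p q] assms by simp
  then have "p \<bullet> q = 1 \<or> p \<bullet> q = -1" by (simp add: power2_eq_1_iff)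
  then show False using unit_eq_or_minus[OF assms(1,2)] assms(3,4) by auto
qed

lemma rotation_matrix_two_fixed:
  fixes A :: "real^3^3"
  assumes "rotation_matrix A" "A *v p = p" "A *v q = q" "norm p = 1" "norm q = 1" "q \<noteq> p" "q \<noteq> - p"
  shows "A = mat 1"
  using rotation_matrix_eqI[OF assms(1) rotation_matrix_mat_1, of p q] assms cross3_unit_nonzero
  by simp

definition e3 :: "real^3" where "e3 = axis 3 1"

definition Rz :: "real \<Rightarrow> real^3^3" where
  "Rz t = vector [vector [cos t, - sin t, 0], vector [sin t, cos t, 0], vector [0, 0, 1]]"

text \<open>The half-turn about the first coordinate axis; on the Riemann sphere it becomes the
  inversion z -> 1/z.\<close>

definition flip :: "real^3^3" where
  "flip = vector [vector [1, 0, 0], vector [0, -1, 0], vector [0, 0, -1]]"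

lemma norm_e3 [simp]: "norm e3 = 1"
  by (simp add: e3_def)

lemma rotation_matrix_Rz: "rotation_matrix (Rz t)"
  unfolding rotation_matrix_def orthogonal_matrix det_3
  by (simp add: Rz_def vec3_simps det_3 power2_eq_square[symmetric])

lemma rotation_matrix_flip: "rotation_matrix flip"
  unfolding rotation_matrix_def orthogonal_matrix det_3
  by (simp add: flip_def vec3_simps det_3)

lemma Rz_add: "Rz s ** Rz t = Rz (s + t)"
  by (simp add: Rz_def vec3_simps cos_add sin_add)

lemma Rz_0: "Rz 0 = mat 1"
  by (simp add: Rz_def vec3_simps)

lemma Rz_e3: "Rz t *v e3 = e3"
  by (simp add: Rz_def e3_def vec3_simps)

lemma flip_e3: "flip *v e3 = - e3"
  by (simp add: flip_def e3_def vec3_simps)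

lemma transpose_Rz: "transpose (Rz t) = Rz (- t)"
  by (simp add: Rz_def vec3_simps)

lemma flip_flip: "flip ** flip = mat 1"
  by (simp add: flip_def vec3_simps)

lemma flip_Rz: "flip ** Rz t = Rz (- t) ** flip"
  by (simp add: Rz_def flip_def vec3_simps)

lemma rotation_matrix_fix_e3:
  fixes A :: "real^3^3"
  assumes A: "rotation_matrix A" and e: "A *v e3 = e3"
  obtains t where "A = Rz t" "0 \<le> t" "t < 2 * pi"
proof -
  have AT: "transpose A *v e3 = e3"
    using rotation_matrix_inverse(4)[OF A, of e3] by (simp add: e)
  have col: "A$1$3 = 0" "A$2$3 = 0" "A$3$3 = 1"
    using e by (simp_all add: e3_def vec3_simps)
  have row: "A$3$1 = 0" "A$3$2 = 0"
    using AT by (simp_all add: e3_def vec3_simps)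
  have ort: "A$1$1 * A$1$1 + A$2$1 * A$2$1 = 1" "A$1$2 * A$1$2 + A$2$2 * A$2$2 = 1"
    using rotation_matrix_inverse(2)[OF A] by (simp_all add: vec3_simps row)
  have "det A = 1" using A by (simp add: rotation_matrix_def)
  then have det: "A$1$1 * A$2$2 - A$1$2 * A$2$1 = 1"
    by (simp add: det_3 row col)
  \<comment> \<open>The four squares of the 2x2 block add up to 2, and the mixed terms are minus
    twice its determinant, which is 1.\<close>
  have "(A$1$1 - A$2$2)\<^sup>2 + (A$1$2 + A$2$1)\<^sup>2 = 0"
    using ort det by (simp add: power2_eq_square algebra_simps)
  then have eq: "A$2$2 = A$1$1" "A$1$2 = - A$2$1"
    by (simp_all add: sum_power2_eq_zero_iff)
  have "(A$1$1)\<^sup>2 + (A$2$1)\<^sup>2 = 1" using ort by (simp add: power2_eq_square)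
  then obtain t where t: "0 \<le> t" "t < 2 * pi" "A$1$1 = cos t" "A$2$1 = sin t"
    using sincos_total_2pi by metis
  have "A = Rz t"
    by (simp add: Rz_def vec_eq_iff forall_3 vector_3 col row eq t)
  with t show ?thesis using that by blast
qed

text \<open>Unit vectors of equal height have horizontal parts of equal modulus; read as complex
  numbers, they differ by a factor \<open>cis t\<close>.\<close>

lemma Rz_height:
  assumes "norm x = 1" "norm y = 1" "x $ 3 = y $ 3"
  shows "\<exists>t. Rz t *v x = y"
proof -
  have n: "(x$1)\<^sup>2 + (x$2)\<^sup>2 + (x$3)\<^sup>2 = 1" "(y$1)\<^sup>2 + (y$2)\<^sup>2 + (y$3)\<^sup>2 = 1"
    using assms(1,2) by (simp_all add: norm_eq_1 inner_vec_def sum_3 power2_eq_square)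
  define x' y' where "x' = Complex (x$1) (x$2)" and "y' = Complex (y$1) (y$2)"
  have eq: "cmod x' = cmod y'"
    using n assms(3) unfolding x'_def y'_def by (simp add: complex_norm)
  obtain t where t: "cis t * x' = y'"
  proof (cases "x' = 0")
    case True
    then show ?thesis using eq that[of 0] by simp
  next
    case False
    show ?thesis
    proof (rule that[of "Arg (y' / x')"])
      have "y' \<noteq> 0" using False eq by auto
      then have "cis (Arg (y' / x')) = y' / x'"
        using False eq by (subst cis_Arg) (auto simp: sgn_eq norm_divide)
      then show "cis (Arg (y' / x')) * x' = y'" using False by simp
    qed
  qed
  have "cos t * x$1 - sin t * x$2 = y$1" "sin t * x$1 + cos t * x$2 = y$2"
    using t unfolding x'_def y'_def by (auto simp: complex_eq_iff)
  then show ?thesis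
    using assms(3) by (intro exI[of _ t]) (simp add: Rz_def vec3_simps algebra_simps)
qed

lemma rotation_to_axis:
  assumes "norm (p :: real^3) = 1"
  obtains C where "rotation_matrix C" "C *v e3 = p"
  using rotation_matrix_exists_basis[of p 3] assms unfolding e3_def by auto

text \<open>Euler's theorem: A - 1 equals A times (1 - transpose A), so det (A - 1) = det (1 - A),
  and in odd dimension this is -det (A - 1). Hence 1 is an eigenvalue.\<close>

lemma rotation_matrix_axis:
  fixes A :: "real^3^3"
  assumes A: "rotation_matrix A"
  obtains p where "norm p = 1" "A *v p = p"
proof -
  have d: "det A = 1" using A by (simp add: rotation_matrix_def)
  have ld: "A ** (B - D) = A ** B - A ** D" for B D :: "real^3^3"
    by (simp add: vec_eq_iff matrix_matrix_mult_def sum_subtractf right_diff_distrib)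
  have tr: "mat 1 - transpose A = transpose (mat 1 - A)"
    by (auto simp: transpose_def mat_def vec_eq_iff)
  have "det (A - mat 1) = det (A ** (mat 1 - transpose A))"
    by (simp add: ld rotation_matrix_inverse[OF A])
  also have "\<dots> = det (transpose (mat 1 - A))"
    unfolding tr by (simp add: det_mul d)
  also have "\<dots> = det (- (A - mat 1))" by simp
  also have "\<dots> = - det (A - mat 1)" by (simp add: det_3 algebra_simps)
  finally have "det (A - mat 1) = 0" by simp
  then have "\<not> invertible (A - mat 1)" by (simp add: invertible_det_nz)
  then obtain x where x: "x \<noteq> 0" "(A - mat 1) *v x = 0"
    unfolding invertible_left_inverse matrix_left_invertible_ker by auto
  then have "A *v x = x" by (simp add: matrix_vector_mult_diff_rdistrib)
  then have "A *v (x /\<^sub>R norm x) = x /\<^sub>R norm x"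
    by (simp add: matrix_vector_mult_scaleR)
  moreover have "norm (x /\<^sub>R norm x) = 1" using x by simp
  ultimately show ?thesis using that by blast
qed

lemma rotation_matrix_conj_Rz:
  fixes A :: "real^3^3"
  assumes A: "rotation_matrix A" and C: "rotation_matrix C" and e: "A *v (C *v e3) = C *v e3"
  obtains t where "A = C ** Rz t ** transpose C" "0 \<le> t" "t < 2 * pi"
proof -
  let ?B = "transpose C ** A ** C"
  have "rotation_matrix ?B"
    by (intro rotation_matrix_mult rotation_matrix_transpose A C)
  moreover have "?B *v e3 = e3"
    by (simp add: matrix_vector_mul_assoc[symmetric] e rotation_matrix_inverse[OF C])
  ultimately obtain t where t: "?B = Rz t" "0 \<le> t" "t < 2 * pi" by (rule rotation_matrix_fix_e3)
  have "C ** ?B ** transpose C = A"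
    by (simp add: matrix_mul_assoc[symmetric] rotation_matrix_inverse[OF C])
  with t that show ?thesis by metis
qed

section \<open>The action on the Riemann sphere\<close>

text \<open>The map \<open>stereo\<close> with its target rewritten as \<open>real^3\<close>, so
  that 3x3 matrices can act on its values.\<close>

definition ster :: "riemann_sphere \<Rightarrow> real^3" where
  "ster x = vector [Re (fst (stereo x)), Im (fst (stereo x)), snd (stereo x)]"

lemma ster_Finite:
  "ster (Finite z) = vector [2 * Re z / (1 + (cmod z)\<^sup>2), 2 * Im z / (1 + (cmod z)\<^sup>2),
     ((cmod z)\<^sup>2 - 1) / ((cmod z)\<^sup>2 + 1)]"
  by (simp add: ster_def)

lemma ster_Infinity: "ster Infinity = e3"
  by (simp add: ster_def e3_def vec3_simps)

lemma dist_ster: "dist (ster x) (ster y) = dist x y"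
  by (simp add: dist_riemann_sphere_def dist_prod_def dist_norm norm_eq_sqrt_inner ster_def
      inner_complex_def inner_vec_def sum_3 vector_3 power2_eq_square)

lemma ster_inject: "ster x = ster y \<longleftrightarrow> x = y"
  by (metis dist_eq_0_iff dist_ster)

text \<open>Stereographic projection in homogeneous coordinates (the Hopf map). It treats infinity
  like any other point, which spares case distinctions when Moebius maps are compared with
  matrices.\<close>

lemma ster_sphere_quot:
  assumes "z \<noteq> 0 \<or> w \<noteq> 0"
  shows "ster (sphere_quot z w) = (1 / ((cmod z)\<^sup>2 + (cmod w)\<^sup>2)) *\<^sub>R
    vector [2 * Re (z * cnj w), 2 * Im (z * cnj w), (cmod z)\<^sup>2 - (cmod w)\<^sup>2]"
proof (cases "w = 0")
  case True
  then show ?thesis using assms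
    by (simp add: sphere_quot_def ster_Infinity e3_def vec3_simps)
next
  case False
  define u where "u = z / w"
  have z: "z = u * w" using False by (simp add: u_def)
  have c: "(cmod w)\<^sup>2 > 0" using False by simp
  have d: "1 + (cmod u)\<^sup>2 > 0" by (simp add: add_pos_nonneg)
  have k: "u * w * cnj w = of_real ((cmod w)\<^sup>2) * u" by (simp only: complex_norm_square mult_ac)
  have N: "(cmod (u * w))\<^sup>2 + (cmod w)\<^sup>2 = (cmod w)\<^sup>2 * (1 + (cmod u)\<^sup>2)"
    by (simp add: norm_mult power_mult_distrib algebra_simps)
  have D: "(cmod (u * w))\<^sup>2 - (cmod w)\<^sup>2 = (cmod w)\<^sup>2 * ((cmod u)\<^sup>2 - 1)"
    by (simp add: norm_mult power_mult_distrib algebra_simps)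
  have "sphere_quot z w = Finite u" using False by (simp add: sphere_quot_def u_def)
  then show ?thesis unfolding z N D k
    using c d False by (simp add: ster_Finite vec_eq_iff forall_3 vector_3 add.commute)
qed

lemma norm_ster: "norm (ster x) = 1"
proof (cases x)
  case (Finite z)
  define A where "A = 1 + (cmod z)\<^sup>2"
  have A: "A > 0" unfolding A_def by (simp add: add_pos_nonneg)
  have "(Re z)\<^sup>2 + (Im z)\<^sup>2 = A - 1" by (simp add: A_def cmod_power2)
  then have "(2 * Re z / A)\<^sup>2 + (2 * Im z / A)\<^sup>2 + ((A - 2) / A)\<^sup>2 = (4 * (A - 1) + (A - 2)\<^sup>2) / A\<^sup>2"
    by (simp add: power_divide add_divide_distrib[symmetric] power_mult_distrib)
  also have "\<dots> = 1" using A by (simp add: power2_eq_square algebra_simps divide_simps)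
  finally show ?thesis
    unfolding Finite norm_eq_1 ster_Finite inner_vec_def sum_3
    by (simp add: vector_3 power2_eq_square[symmetric] A_def add.commute)
qed (simp add: ster_Infinity)

lemma ster_surj:
  assumes "norm p = 1"
  shows "\<exists>x. ster x = p"
proof (cases "p $ 3 = 1")
  case True
  have "p \<bullet> e3 = 1" using True by (simp add: e3_def inner_axis)
  then have "p = e3" using assms unit_eq_or_minus(1)[of p e3] by simp
  then show ?thesis using ster_Infinity by metis
next
  case False
  have n: "(p$1)\<^sup>2 + (p$2)\<^sup>2 + (p$3)\<^sup>2 = 1"
    using assms by (simp add: norm_eq_1 inner_vec_def sum_3 power2_eq_square)
  then have "(p$3)\<^sup>2 \<le> 1" by (smt (verit) zero_le_power2)
  then have "p$3 < 1" using False by (simp add: abs_square_le_1)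
  then have h: "1 - p$3 > 0" by simp
  define r where "r = p$3"
  have n': "(cmod (Complex (p$1) (p$2)))\<^sup>2 = (1 - r) * (1 + r)"
    using n by (simp add: complex_norm r_def power2_eq_square algebra_simps)
  have h': "1 - r > 0" using h by (simp add: r_def)
  \<comment> \<open>Inverse stereographic projection sends p to (p1 + i p2) / (1 - p3); the
    denominator is nonzero away from the north pole.\<close>
  have "ster (sphere_quot (Complex (p$1) (p$2)) (of_real (1 - r))) = p"
  proof (subst ster_sphere_quot)
    have N: "(1 - r) * (1 + r) + (1 - r)\<^sup>2 = 2 * (1 - r)" by (simp add: power2_eq_square algebra_simps)
    have D: "(1 - r) * (1 + r) - (1 - r)\<^sup>2 = 2 * r * (1 - r)" by (simp add: power2_eq_square algebra_simps)
    have M: "(cmod (of_real (1 - r)))\<^sup>2 = (1 - r)\<^sup>2" by (simp only: norm_of_real power2_abs)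
    have R: "Re (Complex (p$1) (p$2) * cnj (of_real (1 - r))) = p$1 * (1 - r)"
      "Im (Complex (p$1) (p$2) * cnj (of_real (1 - r))) = p$2 * (1 - r)" by simp_all
    show "(1 / ((cmod (Complex (p $ 1) (p $ 2)))\<^sup>2 + (cmod (complex_of_real (1 - r)))\<^sup>2)) *\<^sub>R
      vector [2 * Re (Complex (p $ 1) (p $ 2) * cnj (complex_of_real (1 - r))),
        2 * Im (Complex (p $ 1) (p $ 2) * cnj (complex_of_real (1 - r))),
        (cmod (Complex (p $ 1) (p $ 2)))\<^sup>2 - (cmod (complex_of_real (1 - r)))\<^sup>2] = p"
      unfolding n' M N D R using h'
      by (simp add: vec_eq_iff forall_3 vector_3 r_def[symmetric]) (auto simp: field_simps)
  qed (use h' in auto)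
  then show ?thesis by blast
qed

text \<open>\<open>ster\<close> is a bijection onto the unit sphere, so this is the transported
  action whenever A preserves that sphere; the lemmas on its group structure assume a
  rotation.\<close>

definition act :: "real^3^3 \<Rightarrow> riemann_sphere \<Rightarrow> riemann_sphere" where
  "act A x = inv_into UNIV ster (A *v ster x)"

lemma act_eqI: "(\<And>x. ster (f x) = A *v ster x) \<Longrightarrow> act A = f"
  by (rule ext) (metis act_def inv_f_f injI ster_inject)

lemma ster_act: "rotation_matrix A \<Longrightarrow> ster (act A x) = A *v ster x"
  unfolding act_def
  by (rule f_inv_into_f) (metis norm_ster rangeI rotation_matrix_norm ster_surj)

lemma act_mult: "rotation_matrix A \<Longrightarrow> rotation_matrix B \<Longrightarrow> act (A ** B) = act A \<circ> act B"
  by (rule act_eqI) (simp add: ster_act matrix_vector_mul_assoc)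

lemma act_mat_1: "act (mat 1) = id"
  by (rule act_eqI) simp

lemma act_transpose:
  assumes "rotation_matrix A"
  shows "act A (act (transpose A) x) = x" "act (transpose A) (act A x) = x"
proof -
  show "act A (act (transpose A) x) = x" "act (transpose A) (act A x) = x"
    using act_mult[OF assms rotation_matrix_transpose[OF assms]]
      act_mult[OF rotation_matrix_transpose[OF assms] assms] assms
    by (metis act_mat_1 comp_apply id_apply rotation_matrix_inverse(1,2))+
qed

lemma bij_act: "rotation_matrix A \<Longrightarrow> bij (act A)"
  by (rule o_bij[of "act (transpose A)"]) (auto simp: act_transpose)

lemma act_inject:
  assumes A: "rotation_matrix A" and B: "rotation_matrix B" and eq: "act A = act B"
  shows "A = B"
proof -
  have *: "A *v p = B *v p" if "norm p = 1" for p
    using ster_surj[OF that] eq by (metis A B ster_act)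
  show ?thesis
    by (rule rotation_matrix_eqI[OF A B, of "axis 1 1" "axis 2 1"])
      (simp_all add: * cross_basis axis_eq_0_iff)
qed

lemma act_Rz: "act (Rz t) = moebius (cis t) 0 0 1"
proof (rule act_eqI)
  fix x show "ster (moebius (cis t) 0 0 1 x) = Rz t *v ster x"
  proof (cases x)
    case (Finite z)
    show ?thesis unfolding Finite
      by (simp add: sphere_quot_def ster_Finite norm_mult)
        (simp add: Rz_def vec3_simps algebra_simps diff_divide_distrib add_divide_distrib)
  qed (simp add: sphere_quot_def ster_Infinity Rz_e3)
qed

lemma act_flip: "act flip = moebius 0 1 1 0"
proof (rule act_eqI)
  fix x show "ster (moebius 0 1 1 0 x) = flip *v ster x"
  proof (cases x)
    case (Finite z)
    have "ster (sphere_quot 1 z) = flip *v ster (Finite z)"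
      by (subst ster_sphere_quot)
        (simp_all add: flip_def ster_Finite vec_eq_iff forall_3 vector_3 matrix_vector_mult_def sum_3
          add.commute diff_divide_distrib)
    then show ?thesis by (simp add: Finite)
  next
    case Infinity
    have "ster (sphere_quot 0 1) = flip *v ster Infinity"
      by (subst ster_sphere_quot) (simp_all add: flip_e3 ster_Infinity,
          simp add: e3_def axis_def vec_eq_iff forall_3 vector_3)
    then show ?thesis by (simp add: Infinity)
  qed
qed

lemma act_Rz_flip: "act (Rz t ** flip) = moebius 0 (cis t) 1 0"
proof
  fix x show "act (Rz t ** flip) x = moebius 0 (cis t) 1 0 x"
    by (cases x) (auto simp: act_mult rotation_matrix_Rz rotation_matrix_flip act_Rz act_flip
        sphere_quot_def)
qed

section \<open>Holomorphic isometries of the sphere as rotations\<close>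

lemma sphere_quot_cancel: "c \<noteq> 0 \<Longrightarrow> sphere_quot (c * z) (c * w) = sphere_quot z w"
  by (simp add: sphere_quot_def)

lemma moebius_cancel:
  assumes "c \<noteq> 0"
  shows "moebius (k * c) (l * c) (m * c) (n * c) = moebius k l m n"
proof
  fix x show "moebius (k * c) (l * c) (m * c) (n * c) x = moebius k l m n x"
  proof (cases x)
    case (Finite z)
    have "k * c * z + l * c = c * (k * z + l)" "m * c * z + n * c = c * (m * z + n)"
      by (simp_all add: algebra_simps)
    then show ?thesis using Finite assms by (simp add: sphere_quot_cancel)
  next
    case Infinity
    then show ?thesis using sphere_quot_cancel[OF assms, of k m] by (simp add: mult.commute)
  qed
qed

definition Ry :: "real \<Rightarrow> real^3^3" where
  "Ry t = vector [vector [cos t, 0, sin t], vector [0, 1, 0], vector [- sin t, 0, cos t]]"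

lemma rotation_matrix_Ry: "rotation_matrix (Ry t)"
  unfolding rotation_matrix_def orthogonal_matrix det_3
  by (simp add: Ry_def vec3_simps det_3 power2_eq_square[symmetric])

text \<open>The doubled angle reflects the double cover of SO(3) by SU(2): the real matrices of
  SU(2) with angle t act as rotations by 2t about the second axis.\<close>

lemma act_Ry: "act (Ry (2 * t)) = moebius (cos t) (- sin t) (sin t) (cos t)"
proof (rule act_eqI)
  define c s where "c = cos t" and "s = sin t"
  have cs: "c\<^sup>2 + s\<^sup>2 = 1" by (simp add: c_def s_def)
  have cs2: "cos (2 * t) = c\<^sup>2 - s\<^sup>2" "sin (2 * t) = 2 * s * c"
    by (simp_all add: c_def s_def cos_double sin_double)
  have hom: "ster (sphere_quot (c * z - s * w) (s * z + c * w)) = Ry (2 * t) *v ster (sphere_quot z w)"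
    if zw: "z \<noteq> 0 \<or> w \<noteq> 0" for z w :: complex
  proof -
    \<comment> \<open>The four identities give the denominator and the three numerators of the
      projected point as quadratic forms in z and w.\<close>
    have N: "(cmod (c * z - s * w))\<^sup>2 + (cmod (s * z + c * w))\<^sup>2 = (c\<^sup>2 + s\<^sup>2) * ((cmod z)\<^sup>2 + (cmod w)\<^sup>2)"
      unfolding cmod_power2 by (simp add: power2_eq_square algebra_simps)
    have D: "(cmod (c * z - s * w))\<^sup>2 - (cmod (s * z + c * w))\<^sup>2 =
        - (2 * s * c) * (2 * Re (z * cnj w)) + (c\<^sup>2 - s\<^sup>2) * ((cmod z)\<^sup>2 - (cmod w)\<^sup>2)"
      unfolding cmod_power2 by (simp add: power2_eq_square algebra_simps)
    have R: "2 * Re ((c * z - s * w) * cnj (s * z + c * w)) =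
        (c\<^sup>2 - s\<^sup>2) * (2 * Re (z * cnj w)) + (2 * s * c) * ((cmod z)\<^sup>2 - (cmod w)\<^sup>2)"
      unfolding cmod_power2 by (simp add: power2_eq_square algebra_simps)
    have I: "2 * Im ((c * z - s * w) * cnj (s * z + c * w)) = (c\<^sup>2 + s\<^sup>2) * (2 * Im (z * cnj w))"
      by (simp add: power2_eq_square algebra_simps)
    have nz: "c * z - s * w \<noteq> 0 \<or> s * z + c * w \<noteq> 0"
    proof (rule ccontr)
      assume "\<not> ?thesis"
      then have "(cmod z)\<^sup>2 + (cmod w)\<^sup>2 = 0" using N cs by simp
      then show False using zw by (simp add: sum_power2_eq_zero_iff)
    qed
    show ?thesis
      unfolding ster_sphere_quot[OF zw] ster_sphere_quot[OF nz] N D R I cs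
      by (simp add: Ry_def vec_eq_iff forall_3 vector_3 matrix_vector_mult_def sum_3
          cs2 add_divide_distrib diff_divide_distrib)
  qed
  fix x show "ster (moebius (cos t) (- sin t) (sin t) (cos t) x) = Ry (2 * t) *v ster x"
  proof (cases x)
    case (Finite z)
    then show ?thesis using hom[of z 1] by (simp add: sphere_quot_def c_def s_def)
  next
    case Infinity
    then show ?thesis using hom[of 1 0] by (simp add: sphere_quot_def c_def s_def)
  qed
qed

text \<open>Euler angles: with a = cos t \<open>cis \<alpha>\<close> and b = sin t
  \<open>cis \<beta>\<close>, the map is a rotation about the third axis after one about the second
  after one about the third.\<close>

lemma sphere_isometry_is_act:
  assumes "(cmod a)\<^sup>2 + (cmod b)\<^sup>2 = 1"
  obtains A where "rotation_matrix A" "moebius a (- cnj b) b (cnj a) = act A"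
proof -
  obtain t where t: "cmod a = cos t" "cmod b = sin t"
    using sincos_total_2pi[OF assms] by metis
  define \<alpha> \<beta> where "\<alpha> = Arg a" and "\<beta> = Arg b"
  have a: "a = cos t * cis \<alpha>" using rcis_cmod_Arg[of a] by (simp add: t \<alpha>_def rcis_def)
  have b: "b = sin t * cis \<beta>" using rcis_cmod_Arg[of b] by (simp add: t \<beta>_def rcis_def)
  let ?A = "Rz (\<alpha> - \<beta>) ** (Ry (2 * t) ** Rz (\<alpha> + \<beta>))"
  \<comment> \<open>All four coefficients are written with the common phase
    \<open>cis (- \<alpha>)\<close>, which then cancels.\<close>
  have "moebius a (- cnj b) b (cnj a) =
    moebius (cis (\<alpha> - \<beta>) * (cos t * cis (\<alpha> + \<beta>)) * cis (- \<alpha>)) (- cis (\<alpha> - \<beta>) * sin t * cis (- \<alpha>))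
     (sin t * cis (\<alpha> + \<beta>) * cis (- \<alpha>)) (cos t * cis (- \<alpha>))"
    unfolding a b by (simp add: cis_mult cis_cnj mult.assoc mult.left_commute)
  also have "\<dots> = moebius (cis (\<alpha> - \<beta>) * (cos t * cis (\<alpha> + \<beta>))) (- cis (\<alpha> - \<beta>) * sin t)
     (sin t * cis (\<alpha> + \<beta>)) (cos t)"
    by (rule moebius_cancel) simp
  also have "\<dots> = moebius (cis (\<alpha> - \<beta>)) 0 0 1 \<circ>
      (moebius (cos t) (- sin t) (sin t) (cos t) \<circ> moebius (cis (\<alpha> + \<beta>)) 0 0 1)"
  proof
    fix x show "moebius (cis (\<alpha> - \<beta>) * (cos t * cis (\<alpha> + \<beta>))) (- cis (\<alpha> - \<beta>) * sin t)
     (sin t * cis (\<alpha> + \<beta>)) (cos t) x = (moebius (cis (\<alpha> - \<beta>)) 0 0 1 \<circ>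
      (moebius (cos t) (- sin t) (sin t) (cos t) \<circ> moebius (cis (\<alpha> + \<beta>)) 0 0 1)) x"
      by (cases x) (auto simp: sphere_quot_def algebra_simps)
  qed
  also have "\<dots> = act ?A"
    by (simp add: act_mult act_Rz act_Ry rotation_matrix_mult rotation_matrix_Rz rotation_matrix_Ry)
  finally show ?thesis
    using that rotation_matrix_mult rotation_matrix_Rz rotation_matrix_Ry by metis
qed

text \<open>Choose an isometry B with the same image of the north pole as A. Then A differs from B
  by a rotation about \<open>e3\<close>, and precomposing with z -> e^(it) z preserves the normal
  form of isometries.\<close>

lemma act_in_sphere_isometries:
  assumes A: "rotation_matrix A"
  shows "act A \<in> sphere_isometries"
proof -
  obtain x where x: "ster x = A *v e3"
    using ster_surj[of "A *v e3"] by (auto simp: rotation_matrix_norm[OF A])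
  \<comment> \<open>The isometry with parameters a, b sends infinity to [a : b], so x needs
    homogeneous coordinates of norm 1.\<close>
  obtain a b where ab: "(cmod a)\<^sup>2 + (cmod b)\<^sup>2 = 1" "sphere_quot a b = x"
  proof (cases x)
    case (Finite z)
    define r where "r = sqrt (1 + (cmod z)\<^sup>2)"
    have r: "r > 0" "r\<^sup>2 = 1 + (cmod z)\<^sup>2" by (auto simp: r_def add_pos_nonneg)
    show ?thesis
      by (rule that[of "z / r" "1 / r"])
        (use r in \<open>auto simp: norm_divide power_divide sphere_quot_def Finite
          add_divide_distrib[symmetric] add.commute\<close>)
  qed (use that[of 1 0] in \<open>simp add: sphere_quot_def\<close>)
  obtain B where B: "rotation_matrix B" "moebius a (- cnj b) b (cnj a) = act B"
    using sphere_isometry_is_act[OF ab(1)] by metis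
  have "B *v e3 = A *v e3"
    using ster_act[OF B(1), of Infinity] ab(2) x by (simp add: B(2)[symmetric] ster_Infinity)
  then have "(transpose B ** A) *v e3 = e3"
    by (metis B(1) matrix_vector_mul_assoc rotation_matrix_inverse(4))
  then obtain t where "transpose B ** A = Rz t"
    using rotation_matrix_fix_e3 rotation_matrix_mult rotation_matrix_transpose A B(1) by metis
  then have "A = B ** Rz t" by (metis B(1) rotation_matrix_inverse(5))
  then have "act A = moebius a (- cnj b) b (cnj a) \<circ> moebius (cis t) 0 0 1"
    by (simp add: act_mult B rotation_matrix_Rz act_Rz)
  \<comment> \<open>Half of the phase goes into the parameters and half into a common factor; only
    this split restores the conjugate pattern of the coefficients.\<close>
  also have "\<dots> = moebius (a * cis (t / 2) * cis (t / 2)) (- cnj (b * cis (t / 2)) * cis (t / 2))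
      (b * cis (t / 2) * cis (t / 2)) (cnj (a * cis (t / 2)) * cis (t / 2))"
  proof
    fix x show "(moebius a (- cnj b) b (cnj a) \<circ> moebius (cis t) 0 0 1) x =
      moebius (a * cis (t / 2) * cis (t / 2)) (- cnj (b * cis (t / 2)) * cis (t / 2))
      (b * cis (t / 2) * cis (t / 2)) (cnj (a * cis (t / 2)) * cis (t / 2)) x"
      by (cases x) (simp_all add: mult.assoc cis_mult cis_cnj sphere_quot_def)
  qed
  also have "\<dots> = moebius (a * cis (t / 2)) (- cnj (b * cis (t / 2)))
      (b * cis (t / 2)) (cnj (a * cis (t / 2)))"
    by (rule moebius_cancel) simp
  finally show ?thesis
    unfolding sphere_isometries_def mem_Collect_eq using ab(1)
    by (intro exI[of _ "a * cis (t / 2)"] exI[of _ "b * cis (t / 2)"]) (simp add: norm_mult)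
qed

lemma sphere_isometries_eq: "sphere_isometries = act ` {A. rotation_matrix A}"
proof
  show "sphere_isometries \<subseteq> act ` {A. rotation_matrix A}"
    unfolding sphere_isometries_def using sphere_isometry_is_act by auto (metis image_eqI mem_Collect_eq)
qed (auto simp: act_in_sphere_isometries)

section \<open>Groups of rotations preserving an axis\<close>

lemma matrix_vector_mult_uminus: "A *v (- x) = - (A *v x)" for A :: "real^'n^'m"
  by (simp add: matrix_vector_mult_def vec_eq_iff sum_negf)

lemma map_group_mult:
  assumes "bij f" "bij g"
  shows "f \<otimes>\<^bsub>map_group S\<^esub> g = f \<circ> g"
  using assms by (simp add: map_group_def BijGroup_def Bij_def compose_def fun_eq_iff)

text \<open>Two faithful actions of the same matrices, possibly on different spaces, give isomorphic
  groups of maps through \<beta> composed with the inverse of \<alpha>. This links isometries of the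
  Riemann sphere with symmetries of solids in \<open>real^3\<close>.\<close>

lemma map_group_iso:
  assumes bij: "\<And>A. A \<in> G \<Longrightarrow> bij (\<alpha> A)" "\<And>A. A \<in> G \<Longrightarrow> bij (\<beta> A)"
    and inj: "inj_on \<alpha> G" "inj_on \<beta> G"
    and closed: "\<And>A B. A \<in> G \<Longrightarrow> B \<in> G \<Longrightarrow> mul A B \<in> G"
    and hom: "\<And>A B. A \<in> G \<Longrightarrow> B \<in> G \<Longrightarrow> \<alpha> (mul A B) = \<alpha> A \<circ> \<alpha> B"
      "\<And>A B. A \<in> G \<Longrightarrow> B \<in> G \<Longrightarrow> \<beta> (mul A B) = \<beta> A \<circ> \<beta> B"
  shows "map_group (\<alpha> ` G) \<cong> map_group (\<beta> ` G)"
proof -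
  define \<phi> where "\<phi> = (\<lambda>f. \<beta> (inv_into G \<alpha> f))"
  have \<phi>: "\<phi> (\<alpha> A) = \<beta> A" if "A \<in> G" for A
    by (simp add: \<phi>_def inv_into_f_f[OF inj(1) that])
  have "\<phi> \<in> iso (map_group (\<alpha> ` G)) (map_group (\<beta> ` G))"
  proof (rule isoI)
    show "\<phi> \<in> hom (map_group (\<alpha> ` G)) (map_group (\<beta> ` G))"
    proof (rule homI)
      fix f assume "f \<in> carrier (map_group (\<alpha> ` G))"
      then show "\<phi> f \<in> carrier (map_group (\<beta> ` G))" by (auto simp: map_group_def \<phi>)
    next
      fix f g assume "f \<in> carrier (map_group (\<alpha> ` G))" "g \<in> carrier (map_group (\<alpha> ` G))"
      then obtain A B where AB: "A \<in> G" "B \<in> G" "f = \<alpha> A" "g = \<alpha> B" by (auto simp: map_group_def)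
      then show "\<phi> (f \<otimes>\<^bsub>map_group (\<alpha> ` G)\<^esub> g) = \<phi> f \<otimes>\<^bsub>map_group (\<beta> ` G)\<^esub> \<phi> g"
        using hom(1)[OF AB(1,2), symmetric] by (simp add: map_group_mult bij \<phi> closed hom(2))
    qed
    have "bij_betw \<phi> (\<alpha> ` G) (\<beta> ` G)"
      unfolding bij_betw_def inj_on_def using inj by (auto simp: \<phi> inj_on_def image_image)
    then show "bij_betw \<phi> (carrier (map_group (\<alpha> ` G))) (carrier (map_group (\<beta> ` G)))"
      by (simp add: map_group_def)
  qed
  then show ?thesis by (auto simp: is_iso_def)
qed

locale rotation_group =
  fixes G :: "(real^3^3) set"
  assumes rotation: "A \<in> G \<Longrightarrow> rotation_matrix A"
    and one_closed: "mat 1 \<in> G"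
    and mult_closed: "A \<in> G \<Longrightarrow> B \<in> G \<Longrightarrow> A ** B \<in> G"
    and transpose_closed: "A \<in> G \<Longrightarrow> transpose A \<in> G"
begin

lemma act_iso:
  assumes "\<And>A. A \<in> G \<Longrightarrow> bij (\<beta> A)" "inj_on \<beta> G"
    and "\<And>A B. A \<in> G \<Longrightarrow> B \<in> G \<Longrightarrow> \<beta> (A ** B) = \<beta> A \<circ> \<beta> B"
  shows "map_group (act ` G) \<cong> map_group (\<beta> ` G)"
proof (rule map_group_iso[where mul = "(**)"])
  show "inj_on act G" by (rule inj_onI) (metis act_inject rotation)
qed (use assms in \<open>auto intro: bij_act simp: rotation mult_closed act_mult\<close>)

end

text \<open>The direction is chosen so that an axis \<open>C *v e3\<close> of G becomes the axis
  \<open>e3\<close> of the conjugate.\<close>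

definition conj_group :: "real^3^3 \<Rightarrow> (real^3^3) set \<Rightarrow> (real^3^3) set" where
  "conj_group C G = (\<lambda>A. transpose C ** A ** C) ` G"

lemma transpose_mult_rotation:
  fixes A B C :: "real^'n^'n"
  assumes "rotation_matrix C"
  shows "(transpose C ** A ** C) ** (transpose C ** B ** C) = transpose C ** (A ** B) ** C"
  by (simp add: matrix_mul_assoc[symmetric] rotation_matrix_inverse[OF assms])

lemma conj_rotation_cancel:
  fixes A C :: "real^'n^'n"
  assumes "rotation_matrix C"
  shows "C ** (transpose C ** A ** C) ** transpose C = A"
    "transpose C ** (C ** A ** transpose C) ** C = A"
  by (simp_all add: matrix_mul_assoc[symmetric] rotation_matrix_inverse[OF assms])

lemma (in rotation_group) rotation_group_conj:
  assumes C: "rotation_matrix C"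
  shows "rotation_group (conj_group C G)"
proof
  show "rotation_matrix A" if A: "A \<in> conj_group C G" for A
  proof -
    obtain B where "A = transpose C ** B ** C" "B \<in> G" using A by (auto simp: conj_group_def)
    then show ?thesis by (simp add: rotation_matrix_mult rotation_matrix_transpose C rotation)
  qed
  have "transpose C ** mat 1 ** C = mat 1" by (simp add: rotation_matrix_inverse[OF C])
  then show "mat 1 \<in> conj_group C G" unfolding conj_group_def using one_closed by (metis image_eqI)
  show "A ** B \<in> conj_group C G" if A: "A \<in> conj_group C G" and B: "B \<in> conj_group C G" for A B
  proof -
    obtain A' where A': "A = transpose C ** A' ** C" "A' \<in> G" using A by (auto simp: conj_group_def)
    obtain B' where B': "B = transpose C ** B' ** C" "B' \<in> G" using B by (auto simp: conj_group_def)
    show ?thesis unfolding A'(1) B'(1) transpose_mult_rotation[OF C]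
      by (simp add: conj_group_def mult_closed A' B')
  qed
  show "transpose A \<in> conj_group C G" if A: "A \<in> conj_group C G" for A
  proof -
    obtain A' where A': "A = transpose C ** A' ** C" "A' \<in> G" using A by (auto simp: conj_group_def)
    then have "transpose A = transpose C ** transpose A' ** C"
      by (simp add: matrix_transpose_mul matrix_mul_assoc)
    then show ?thesis using transpose_closed[OF A'(2)] by (auto simp: conj_group_def)
  qed
qed

lemma conj_group_iff:
  assumes C: "rotation_matrix C"
  shows "A \<in> conj_group C G \<longleftrightarrow> C ** A ** transpose C \<in> G"
  unfolding conj_group_def using conj_rotation_cancel[OF C] by (metis (no_types, lifting) image_iff)

lemma (in rotation_group) map_group_conj:
  assumes C: "rotation_matrix C"
  shows "map_group (act ` G) \<cong> map_group (act ` conj_group C G)"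
proof -
  interpret C: rotation_group "conj_group C G" by (rule rotation_group_conj[OF C])
  have mem: "transpose C ** A ** C \<in> conj_group C G" if "A \<in> G" for A
    using that by (simp add: conj_group_def)
  have "map_group (act ` G) \<cong> map_group ((\<lambda>A. act (transpose C ** A ** C)) ` G)"
  proof (rule act_iso)
    show "inj_on (\<lambda>A. act (transpose C ** A ** C)) G"
      by (rule inj_onI) (metis C C.rotation act_inject conj_rotation_cancel(1) mem)
    show "act (transpose C ** (A ** B) ** C) = act (transpose C ** A ** C) \<circ> act (transpose C ** B ** C)"
      if "A \<in> G" "B \<in> G" for A B
      using that by (simp add: act_mult[symmetric] C.rotation mem transpose_mult_rotation[OF C])
  qed (auto intro: bij_act C.rotation mem)
  then show ?thesis by (simp add: conj_group_def image_image)
qed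

text \<open>Injectivity excludes \<mu> = 0, so the map fixes infinity and comes from some
  \<open>Rz t\<close>; its value at 1 identifies \<mu>. For exponent 0 in
  \<open>roots_of_unity_maps\<close> this is where the modulus 1 comes from.\<close>

lemma moebius_rotation:
  assumes "moebius \<mu> 0 0 1 \<in> sphere_isometries"
  obtains t where "\<mu> = cis t"
proof -
  obtain A where A: "rotation_matrix A" "moebius \<mu> 0 0 1 = act A"
    using assms sphere_isometries_eq by auto
  have mu: "\<mu> \<noteq> 0"
  proof
    assume "\<mu> = 0"
    then have "act A (Finite 0) = act A (Finite 1)" by (simp add: A(2)[symmetric])
    then show False using bij_act[OF A(1)] by (simp add: bij_def inj_eq)
  qed
  then have "A *v e3 = e3"
    using ster_act[OF A(1), of Infinity] by (simp add: A(2)[symmetric] sphere_quot_def ster_Infinity)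
  then obtain t where "A = Rz t" using rotation_matrix_fix_e3 A(1) by metis
  then have "moebius \<mu> 0 0 1 (Finite 1) = moebius (cis t) 0 0 1 (Finite 1)"
    by (simp only: A act_Rz)
  then show ?thesis using that by (simp add: sphere_quot_def)
qed

lemma cis_eq_Rz_eq: "cis s = cis t \<Longrightarrow> Rz s = Rz t"
  by (auto simp: Rz_def complex_eq_iff)

lemma BijGroup_act_mult:
  assumes "rotation_matrix A" "rotation_matrix B"
  shows "act A \<otimes>\<^bsub>BijGroup UNIV\<^esub> act B = act (A ** B)"
  using bij_act[OF assms(1)] bij_act[OF assms(2)] act_mult[OF assms]
  by (simp add: BijGroup_def Bij_def compose_def fun_eq_iff)

lemma (in rotation_group) subgroup_act: "subgroup (act ` G) (BijGroup UNIV)"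
proof -
  interpret B: Group.group "BijGroup (UNIV :: riemann_sphere set)" by (rule group_BijGroup)
  have carrier: "act A \<in> carrier (BijGroup UNIV)" if "A \<in> G" for A
    using bij_act[OF rotation[OF that]] by (simp add: BijGroup_def Bij_def)
  have id: "\<one>\<^bsub>BijGroup UNIV\<^esub> = act (mat 1)" by (simp add: BijGroup_def act_mat_1 fun_eq_iff)
  show ?thesis
  proof (rule B.subgroupI)
    show "inv\<^bsub>BijGroup UNIV\<^esub> f \<in> act ` G" if f: "f \<in> act ` G" for f
    proof -
      obtain A where A: "A \<in> G" "f = act A" using f by auto
      have "act (transpose A) \<otimes>\<^bsub>BijGroup UNIV\<^esub> act A = \<one>\<^bsub>BijGroup UNIV\<^esub>"
        by (simp add: id BijGroup_act_mult rotation A transpose_closed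
            rotation_matrix_inverse[OF rotation[OF A(1)]])
      then have "inv\<^bsub>BijGroup UNIV\<^esub> f = act (transpose A)"
        unfolding A(2) by (rule B.inv_equality) (auto intro: carrier A transpose_closed)
      then show ?thesis using A transpose_closed by auto
    qed
  qed (use carrier one_closed mult_closed in \<open>auto simp: BijGroup_act_mult rotation\<close>)
qed

text \<open>Multiplication by u permutes U, so comparing the products over U gives u^n = 1 for n =
  \<open>card U\<close>. There are at most n such roots, hence U contains all of them.\<close>

lemma finite_circle_group:
  fixes U :: "complex set"
  assumes fin: "finite U" and one: "1 \<in> U" and mult: "\<And>u v. u \<in> U \<Longrightarrow> v \<in> U \<Longrightarrow> u * v \<in> U"
    and circ: "\<And>u. u \<in> U \<Longrightarrow> cmod u = 1"
  obtains k :: nat where "k \<ge> 1" "U = {z. z ^ k = 1}"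
proof (rule that)
  show k: "card U \<ge> 1" using fin one by (simp add: Suc_le_eq card_gt_0_iff) auto
  have "u ^ card U = 1" if u: "u \<in> U" for u
  proof -
    have u0: "u \<noteq> 0" using circ[OF u] by auto
    have "inj_on ((*) u) U" using u0 by (auto intro: inj_onI)
    moreover have "(*) u ` U \<subseteq> U" using mult[OF u] by auto
    ultimately have "(*) u ` U = U" using fin by (simp add: endo_inj_surj)
    then have "\<Prod>U = (\<Prod>x\<in>U. u * x)"
      using prod.reindex[OF \<open>inj_on ((*) u) U\<close>, of "\<lambda>x. x"] by simp
    also have "\<dots> = u ^ card U * \<Prod>U" by (simp add: prod.distrib)
    finally have "\<Prod>U * (u ^ card U - 1) = 0" by (simp add: algebra_simps)
    moreover have "\<Prod>U \<noteq> 0" using fin circ[of 0] by auto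
    ultimately show ?thesis by simp
  qed
  then have "U \<subseteq> {z. z ^ card U = 1}" by auto
  moreover have "card {z::complex. z ^ card U = 1} \<le> card U"
    using k card_roots_unity by blast
  moreover have "finite {z::complex. z ^ card U = 1}"
    using k by (intro finite_roots_unity)
  ultimately show "U = {z. z ^ card U = 1}"
    by (metis card_seteq)
qed

lemma Rz_power_mem:
  assumes "rotation_group G" "Rz t \<in> G"
  shows "Rz (of_nat j * t) \<in> G"
proof (induction j)
  case 0
  then show ?case using rotation_group.one_closed[OF assms(1)] by (simp add: Rz_0)
next
  case (Suc j)
  have "Rz (of_nat (Suc j) * t) = Rz t ** Rz (of_nat j * t)" by (simp add: Rz_add algebra_simps)
  then show ?case using rotation_group.mult_closed[OF assms(1,2) Suc] by simp
qed

text \<open>The rotations about \<open>e3\<close> in G correspond to a subgroup U of the unit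
  circle. U decides between the finite and the continuous cases, and the presence of an element
  reversing the axis decides between cyclic and dihedral type. The second hypothesis serves finite
  groups and groups containing a full circle at once.\<close>

lemma (in rotation_group) axial_cases:
  assumes axis: "\<And>A. A \<in> G \<Longrightarrow> A *v e3 = e3 \<or> A *v e3 = - e3"
    and fin: "finite G \<or> (\<forall>t. Rz t \<in> G)"
  shows "(\<exists>k::int. map_group (act ` G) \<cong> map_group (roots_of_unity_maps k)) \<or>
     (\<exists>k::nat. k \<ge> 1 \<and> map_group (act ` G) \<cong> map_group (dihedral_maps k)) \<or>
     map_group (act ` G) \<cong> map_group O1_O2_maps"
proof -
  define U where "U = {cis t | t. Rz t \<in> G}"
  have U: "cis t \<in> U \<longleftrightarrow> Rz t \<in> G" for t
    unfolding U_def mem_Collect_eq using cis_eq_Rz_eq by metis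
  have Ucases: "(\<exists>k::nat. k \<ge> 1 \<and> U = {z. z ^ k = 1}) \<or> (\<forall>t. Rz t \<in> G)"
  proof (cases "finite G")
    case True
    have "U \<subseteq> (\<lambda>A. Complex (A$1$1) (A$2$1)) ` G"
    proof
      fix u assume "u \<in> U"
      then obtain t where "u = cis t" "Rz t \<in> G" by (auto simp: U_def)
      then show "u \<in> (\<lambda>A. Complex (A$1$1) (A$2$1)) ` G"
        by (intro image_eqI[of _ _ "Rz t"]) (simp_all add: Rz_def vector_3 complex_eq_iff)
    qed
    then have "finite U" using True finite_surj by blast
    moreover have "1 \<in> U" using U[of 0] one_closed by (simp add: Rz_0)
    moreover have "u * v \<in> U" if uv: "u \<in> U" "v \<in> U" for u v
    proof -
      obtain s t where "u = cis s" "v = cis t" "Rz s \<in> G" "Rz t \<in> G" using uv by (auto simp: U_def)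
      then show ?thesis using U[of "s + t"] mult_closed[of "Rz s" "Rz t"] by (simp add: cis_mult Rz_add)
    qed
    moreover have "cmod u = 1" if "u \<in> U" for u using that by (auto simp: U_def)
    ultimately show ?thesis using finite_circle_group by metis
  qed (use fin in blast)
  have isom: "moebius (cis t) 0 0 1 \<in> sphere_isometries" for t
    using act_in_sphere_isometries[OF rotation_matrix_Rz] by (simp add: act_Rz)
  show ?thesis
  proof (cases "\<exists>A\<in>G. A *v e3 = - e3")
    case False
    have G: "A \<in> G \<longleftrightarrow> (\<exists>t. A = Rz t \<and> cis t \<in> U)" for A
      using False axis rotation_matrix_fix_e3[OF rotation] by (metis U)
    have actG: "act ` G = {moebius (cis t) 0 0 1 | t. cis t \<in> U}"
      using G by (auto simp: act_Rz[symmetric])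
    from Ucases show ?thesis
    proof
      assume "\<exists>k::nat. k \<ge> 1 \<and> U = {z. z ^ k = 1}"
      then obtain k :: nat where "k \<ge> 1" "U = {z. z ^ k = 1}" by auto
      then have "act ` G = roots_of_unity_maps (int k)"
        unfolding actG roots_of_unity_maps_def using isom by (auto elim: moebius_rotation)
      then show ?thesis using iso_refl by metis
    next
      assume "\<forall>t. Rz t \<in> G"
      \<comment> \<open>The exponent 0 imposes no condition on \<mu>, so it describes the full
        circle of rotations.\<close>
      then have "act ` G = roots_of_unity_maps 0"
        unfolding actG roots_of_unity_maps_def U using isom by (auto elim: moebius_rotation)
      then show ?thesis using iso_refl by metis
    qed
  next
    case True
    have flipform: "\<exists>t. A = Rz t ** flip" if A: "A \<in> G" "A *v e3 = - e3" for A
    proof -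
      have "(A ** flip) *v e3 = e3"
        by (simp add: matrix_vector_mul_assoc[symmetric] flip_e3 A(2) matrix_vector_mult_uminus)
      then obtain t where "A ** flip = Rz t"
        using rotation_matrix_fix_e3 rotation_matrix_mult rotation_matrix_flip rotation[OF A(1)] by metis
      then have "A = Rz t ** flip" by (metis flip_flip matrix_mul_assoc matrix_mul_rid)
      then show ?thesis by blast
    qed
    obtain s where s: "Rz s ** flip \<in> G" using True flipform by metis
    \<comment> \<open>Since \<open>flip\<close> inverts \<open>Rz\<close>, conjugating
      \<open>flip\<close> by half the angle yields \<open>Rz s ** flip\<close>; the conjugate group
      therefore contains \<open>flip\<close> itself.\<close>
    define C where "C = Rz (s / 2)"
    have C: "rotation_matrix C" by (simp add: C_def rotation_matrix_Rz)
    define H where "H = conj_group C G"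
    interpret H: rotation_group H unfolding H_def by (rule rotation_group_conj[OF C])
    have RzH: "Rz t \<in> H \<longleftrightarrow> cis t \<in> U" for t
      unfolding H_def conj_group_iff[OF C] by (simp add: C_def transpose_Rz Rz_add U)
    have "C ** flip ** transpose C = Rz s ** flip"
      by (simp add: C_def transpose_Rz matrix_mul_assoc[symmetric] flip_Rz)
        (simp add: matrix_mul_assoc Rz_add)
    then have flipH: "flip \<in> H" using s by (simp add: H_def conj_group_iff[OF C])
    have H: "A \<in> H \<longleftrightarrow> (\<exists>t. (A = Rz t \<or> A = Rz t ** flip) \<and> cis t \<in> U)" for A
    proof
      assume A: "A \<in> H"
      then obtain B where B: "B \<in> G" "A = transpose C ** B ** C" by (auto simp: H_def conj_group_def)
      have Ae: "A *v e3 = e3 \<or> A *v e3 = - e3"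
        using axis[OF B(1)]
        by (auto simp: B(2) C_def transpose_Rz matrix_vector_mul_assoc[symmetric] Rz_e3
            matrix_vector_mult_uminus)
      show "\<exists>t. (A = Rz t \<or> A = Rz t ** flip) \<and> cis t \<in> U"
      proof (cases "A *v e3 = e3")
        case True
        then obtain t where "A = Rz t" using rotation_matrix_fix_e3 H.rotation[OF A] by metis
        then show ?thesis using A RzH by blast
      next
        case False
        then have "A *v e3 = - e3" using Ae by simp
        then have "(A ** flip) *v e3 = e3"
          by (simp add: matrix_vector_mul_assoc[symmetric] flip_e3 matrix_vector_mult_uminus)
        moreover have AF: "A ** flip \<in> H" using A flipH H.mult_closed by blast
        ultimately obtain t where t: "A ** flip = Rz t" using rotation_matrix_fix_e3 H.rotation by metis
        then have "A = Rz t ** flip" by (metis flip_flip matrix_mul_assoc matrix_mul_rid)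
        then show ?thesis using AF RzH t by metis
      qed
    qed (use RzH flipH H.mult_closed in auto)
    have actH: "act ` H = {moebius (cis t) 0 0 1 | t. cis t \<in> U} \<union> {moebius 0 (cis t) 1 0 | t. cis t \<in> U}"
      unfolding act_Rz[symmetric] act_Rz_flip[symmetric] using H by auto
    have iso: "map_group (act ` G) \<cong> map_group (act ` H)"
      unfolding H_def by (rule map_group_conj[OF C])
    from Ucases show ?thesis
    proof
      assume "\<exists>k::nat. k \<ge> 1 \<and> U = {z. z ^ k = 1}"
      then obtain k :: nat where k: "k \<ge> 1" "U = {z. z ^ k = 1}" by auto
      interpret B: Group.group "BijGroup (UNIV :: riemann_sphere set)" by (rule group_BijGroup)
      let ?S = "{act (Rz (2 * pi / real k)), act flip}"
      have "cis (2 * pi / real k) ^ k = 1"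
        using k(1) by (subst Complex.DeMoivre) simp
      then have "?S \<subseteq> act ` H"
        using k(2) flipH by (auto simp: RzH intro!: imageI)
      then have incl: "generate (BijGroup UNIV) ?S \<subseteq> act ` H"
        using B.generate_subgroup_incl H.subgroup_act by blast
      have gc: "?S \<subseteq> carrier (BijGroup UNIV)"
        using bij_act[OF rotation_matrix_Rz] bij_act[OF rotation_matrix_flip]
        by (auto simp: BijGroup_def Bij_def)
      have pow: "act (Rz (real j * (2 * pi / real k))) \<in> generate (BijGroup UNIV) ?S" for j
      proof (induction j)
        case 0
        have "act (Rz 0) = \<one>\<^bsub>BijGroup UNIV\<^esub>" by (simp add: Rz_0 BijGroup_def act_mat_1 fun_eq_iff)
        then show ?case by (simp add: generate.one)
      next
        case (Suc j)
        have "act (Rz (real (Suc j) * (2 * pi / real k))) =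
            act (Rz (2 * pi / real k)) \<otimes>\<^bsub>BijGroup UNIV\<^esub> act (Rz (real j * (2 * pi / real k)))"
          by (simp add: BijGroup_act_mult rotation_matrix_Rz Rz_add ring_distribs add_divide_distrib)
        then show ?case using generate.eng[OF generate.incl Suc] by (metis insertI1)
      qed
      have rz: "act (Rz t) \<in> generate (BijGroup UNIV) ?S" if t: "cis t \<in> U" for t
      proof -
        have "cis t \<in> {z. z ^ k = 1}" using t k by simp
        then obtain j where "cis t = cis (2 * pi * real j / real k)"
          using Complex.bij_betw_roots_unity[of k] k(1) by (auto simp: bij_betw_def)
        then have "Rz t = Rz (real j * (2 * pi / real k))"
          by (intro cis_eq_Rz_eq) (simp add: mult.commute mult.left_commute)
        then show ?thesis using pow by simp
      qed
      have "act (Rz t ** flip) \<in> generate (BijGroup UNIV) ?S" if t: "cis t \<in> U" for t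
      proof -
        have "act flip \<in> generate (BijGroup UNIV) ?S" by (rule generate.incl) simp
        then show ?thesis
          using generate.eng[OF rz[OF t]] by (metis BijGroup_act_mult rotation_matrix_Rz rotation_matrix_flip)
      qed
      then have "act ` H \<subseteq> generate (BijGroup UNIV) ?S" using rz H by auto
      with incl have "act ` H = dihedral_maps k"
        by (simp add: dihedral_maps_def act_Rz act_flip)
      then show ?thesis using iso k(1) by metis
    next
      assume "\<forall>t. Rz t \<in> G"
      then have "cis t \<in> U" for t by (simp add: U)
      \<comment> \<open>\<open>O1_O2_maps\<close> lists angles in one period only, whereas U is
        described by arbitrary real angles.\<close>
      have range: "{f (cis t) | t. cis t \<in> U} = {f (cis t) | t. t \<in> {0..<2 * pi}}"
        for f :: "complex \<Rightarrow> riemann_sphere \<Rightarrow> riemann_sphere"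
      proof
        show "{f (cis t) | t. cis t \<in> U} \<subseteq> {f (cis t) | t. t \<in> {0..<2 * pi}}"
        proof clarify
          fix t
          obtain s where "0 \<le> s" "s < 2 * pi" "cos t = cos s" "sin t = sin s"
            using sincos_total_2pi[of "cos t" "sin t"] by auto
          then show "\<exists>s. f (cis t) = f (cis s) \<and> s \<in> {0..<2 * pi}"
            by (intro exI[of _ s]) (simp add: cis.code)
        qed
      qed (use \<open>\<And>t. cis t \<in> U\<close> in blast)
      have "act ` H = O1_O2_maps"
        unfolding actH O1_O2_maps_def range range[of "\<lambda>u. moebius 0 u 1 0"]
          range[of "\<lambda>u. moebius u 0 0 1"] ..
      then show ?thesis using iso by metis
    qed
  qed
qed

section \<open>Infinite closed groups\<close>

lemma tendsto_matrix_mult [tendsto_intros]: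
  fixes f g :: "'b \<Rightarrow> real^'n^'n"
  assumes "(f \<longlongrightarrow> a) F" "(g \<longlongrightarrow> b) F"
  shows "((\<lambda>x. f x ** g x) \<longlongrightarrow> a ** b) F"
  unfolding matrix_matrix_mult_def by (intro tendsto_intros assms)

lemma tendsto_matrix_transpose [tendsto_intros]:
  fixes f :: "'b \<Rightarrow> real^'n^'n"
  assumes "(f \<longlongrightarrow> a) F"
  shows "((\<lambda>x. transpose (f x)) \<longlongrightarrow> transpose a) F"
  unfolding transpose_def by (intro tendsto_intros assms)

lemma tendsto_matrix_vector [tendsto_intros]:
  fixes f :: "'b \<Rightarrow> real^'n^'m"
  assumes "(f \<longlongrightarrow> a) F" "(g \<longlongrightarrow> b) F"
  shows "((\<lambda>x. f x *v g x) \<longlongrightarrow> a *v b) F"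
  unfolding matrix_vector_mult_def by (intro tendsto_intros assms)

lemma tendsto_Rz:
  assumes "(f \<longlongrightarrow> t) F"
  shows "((\<lambda>x. Rz (f x)) \<longlongrightarrow> Rz t) F"
proof (rule vec_tendstoI, rule vec_tendstoI)
  have *: "\<forall>i j. ((\<lambda>x. Rz (f x) $ i $ j) \<longlongrightarrow> Rz t $ i $ j) F"
    unfolding forall_3 Rz_def vector_3 by (intro conjI tendsto_const tendsto_minus isCont_tendsto_compose[OF isCont_sin assms]
      isCont_tendsto_compose[OF isCont_cos assms])
  show "((\<lambda>x. Rz (f x) $ i $ j) \<longlongrightarrow> Rz t $ i $ j) F" for i j using * by blast
qed

lemma compact_rotations: "compact {A :: real^3^3. rotation_matrix A}"
proof -
  have "bounded {A :: real^3^3. rotation_matrix A}"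
  proof (rule boundedI)
    fix A :: "real^3^3" assume "A \<in> {A. rotation_matrix A}"
    then have A: "A ** transpose A = mat 1" by (simp add: rotation_matrix_inverse)
    have "norm (A $ i) = 1" for i
    proof -
      have "(A ** transpose A) $ i $ i = 1" unfolding A by (simp add: mat_def)
      then show ?thesis
        by (simp add: norm_eq_1 inner_vec_def matrix_matrix_mult_def transpose_def)
    qed
    then have "L2_set (\<lambda>i. norm (A $ i)) UNIV \<le> sum (\<lambda>i::3. 1) UNIV"
      using L2_set_le_sum[of UNIV "\<lambda>i. norm (A $ i)"] by simp
    then show "norm A \<le> 3" by (simp add: norm_vec_def)
  qed
  moreover have "closed {A :: real^3^3. rotation_matrix A}"
    unfolding closed_sequential_limits
  proof (intro allI impI, elim conjE)
    fix X and L :: "real^3^3"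
    assume X: "\<forall>n. X n \<in> {A. rotation_matrix A}" and L: "X \<longlonglongrightarrow> L"
    have "(\<lambda>n. transpose (X n) ** X n) \<longlonglongrightarrow> transpose L ** L"
      by (intro tendsto_intros L)
    moreover have "(\<lambda>n. transpose (X n) ** X n) = (\<lambda>n. mat 1)"
      using X by (simp add: rotation_matrix_inverse fun_eq_iff)
    ultimately have 1: "transpose L ** L = mat 1" using LIMSEQ_unique tendsto_const by metis
    have "(\<lambda>n. det (X n)) \<longlonglongrightarrow> det L"
      unfolding det_3 by (intro tendsto_intros L)
    moreover have "(\<lambda>n. det (X n)) = (\<lambda>n. 1)"
      using X by (simp add: rotation_matrix_def fun_eq_iff)
    ultimately have "det L = 1" using LIMSEQ_unique tendsto_const by metis
    with 1 show "L \<in> {A. rotation_matrix A}" by (simp add: rotation_matrix_def orthogonal_matrix)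
  qed
  ultimately show ?thesis by (simp add: compact_eq_bounded_closed)
qed

text \<open>The trace reads off the angle independently of the axis, so convergence of matrices to
  the identity gives convergence of angles.\<close>

lemma trace_conj_Rz:
  assumes "rotation_matrix C"
  shows "trace (C ** Rz t ** transpose C) = 1 + 2 * cos t"
proof -
  have "trace (C ** Rz t ** transpose C) = trace (transpose C ** (C ** Rz t))"
    by (rule trace_mul_sym)
  also have "\<dots> = trace (Rz t)" by (simp add: rotation_matrix_inverse[OF assms])
  finally show ?thesis by (simp add: trace_def Rz_def sum_3 vector_3)
qed

text \<open>An angle above pi is replaced by that of the inverse rotation, which has the same trace.
  In the range up to pi the angle can be recovered by \<open>arccos\<close>.\<close>

lemma (in rotation_group) small_angle_form:
  assumes "B \<in> G" "B \<noteq> mat 1"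
  obtains C t where "rotation_matrix C" "0 < t" "t \<le> pi" "C ** Rz t ** transpose C \<in> G"
    "trace B = 1 + 2 * cos t"
proof -
  obtain p where p: "norm p = 1" "B *v p = p" using rotation_matrix_axis rotation assms(1) by metis
  obtain C where C: "rotation_matrix C" "C *v e3 = p" using rotation_to_axis p(1) by metis
  obtain t where t: "B = C ** Rz t ** transpose C" "0 \<le> t" "t < 2 * pi"
    using rotation_matrix_conj_Rz[OF rotation[OF assms(1)] C(1)] C(2) p(2) by metis
  have t0: "t \<noteq> 0"
    using assms(2) t(1) by (auto simp: Rz_0 rotation_matrix_inverse[OF C(1)])
  have tr: "trace B = 1 + 2 * cos t" unfolding t(1) by (rule trace_conj_Rz[OF C(1)])
  show ?thesis
  proof (cases "t \<le> pi")
    case True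
    then show ?thesis using that[OF C(1), of t] t t0 tr assms(1) by simp
  next
    case False
    have "transpose B = C ** transpose (Rz t) ** transpose C"
      unfolding t(1) by (simp add: matrix_transpose_mul matrix_mul_assoc)
    also have "transpose (Rz t) = Rz (2 * pi - t)"
      unfolding transpose_Rz by (rule cis_eq_Rz_eq) (simp add: complex_eq_iff)
    finally have "C ** Rz (2 * pi - t) ** transpose C \<in> G"
      using transpose_closed[OF assms(1)] by simp
    then show ?thesis using that[OF C(1), of "2 * pi - t"] False t tr by simp
  qed
qed

lemma (in rotation_group) conj_Rz_multiple:
  assumes C: "rotation_matrix C" and "C ** Rz t ** transpose C \<in> G"
  shows "C ** Rz (of_nat j * t) ** transpose C \<in> G"
proof -
  have "Rz t \<in> conj_group C G" using assms by (simp add: conj_group_iff)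
  then have "Rz (of_nat j * t) \<in> conj_group C G" by (rule Rz_power_mem[OF rotation_group_conj[OF C]])
  then show ?thesis using C by (simp add: conj_group_iff)
qed

text \<open>Elements accumulating at the identity are rotations by small angles \<open>t\<^sub>n\<close>; their powers
  approximate a rotation by an arbitrary angle about a limit of their axes.\<close>

lemma (in rotation_group) infinite_contains_circle:
  assumes closed: "closed G" and inf: "infinite G"
  obtains C where "rotation_matrix C" "\<And>t. Rz t \<in> conj_group C G"
proof -
  have "compact G"
    using compact_Int_closed[OF compact_rotations closed] rotation
    by (metis (no_types, lifting) Int_absorb1 mem_Collect_eq subsetI)
  then obtain A where A: "A \<in> G" "A islimpt G"
    using inf by (metis compact_eq_Bolzano_Weierstrass subset_refl)
  then obtain f where f: "\<And>n. f n \<in> G - {A}" "f \<longlonglongrightarrow> A"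
    unfolding islimpt_sequential by blast
  \<comment> \<open>Left translation moves the accumulation from A to the identity while keeping
    every term different from the limit.\<close>
  define B where "B n = transpose A ** f n" for n
  have BG: "B n \<in> G" for n using f(1)[of n] A by (simp add: B_def mult_closed transpose_closed)
  have B1: "B n \<noteq> mat 1" for n
  proof
    assume "B n = mat 1"
    then have "A ** (transpose A ** f n) = A" by (simp add: B_def)
    then have "f n = A" unfolding rotation_matrix_inverse(5)[OF rotation[OF A(1)]] .
    then show False using f(1)[of n] by simp
  qed
  have "B \<longlonglongrightarrow> transpose A ** A" unfolding B_def by (intro tendsto_intros f(2))
  then have Blim: "B \<longlonglongrightarrow> mat 1" by (simp add: rotation_matrix_inverse rotation A(1))
  have "\<forall>n. \<exists>C t. rotation_matrix C \<and> 0 < t \<and> t \<le> pi \<and> C ** Rz t ** transpose C \<in> G \<and>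
      trace (B n) = 1 + 2 * cos t"
    using small_angle_form[OF BG B1] by metis
  then obtain C t where C: "\<And>n. rotation_matrix (C n)" and t: "\<And>n. 0 < t n" "\<And>n. t n \<le> pi"
    and CG: "\<And>n. C n ** Rz (t n) ** transpose (C n) \<in> G"
    and tr: "\<And>n. trace (B n) = 1 + 2 * cos (t n)"
    by metis
  have "(\<lambda>n. trace (B n)) \<longlonglongrightarrow> trace (mat 1 :: real^3^3)"
    unfolding trace_def by (intro tendsto_intros Blim)
  then have "(\<lambda>n. 1 + 2 * cos (t n)) \<longlonglongrightarrow> 3" by (simp add: tr[symmetric] trace_I[where ?'n = 3])
  then have "(\<lambda>n. ((1 + 2 * cos (t n)) - 1) / 2) \<longlonglongrightarrow> (3 - 1) / 2" by (intro tendsto_intros) auto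
  then have "(\<lambda>n. cos (t n)) \<longlonglongrightarrow> 1" by simp
  then have "(\<lambda>n. arccos (cos (t n))) \<longlonglongrightarrow> arccos 1"
    by (intro continuous_on_tendsto_compose[OF continuous_on_arccos']) auto
  then have tlim: "t \<longlonglongrightarrow> 0" using t by (simp add: arccos_cos less_imp_le)
  \<comment> \<open>Compactness makes the frames, and with them the axes, converge along a
    subsequence.\<close>
  obtain D r where D: "D \<in> {A. rotation_matrix A}" "strict_mono r" "(C \<circ> r) \<longlonglongrightarrow> D"
    using compact_rotations C unfolding compact_def by (metis (no_types, lifting) mem_Collect_eq)
  have rD: "rotation_matrix D" using D(1) by simp
  have tr0: "(\<lambda>n. t (r n)) \<longlonglongrightarrow> 0"
    using LIMSEQ_subseq_LIMSEQ[OF tlim D(2)] by (simp add: o_def)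
  have pos: "Rz \<alpha> \<in> conj_group D G" if "\<alpha> \<ge> 0" for \<alpha>
  proof -
    \<comment> \<open>The multiple of the small angle nearest to \<alpha> from below; its error is
      at most \<open>t (r n)\<close>, which tends to 0.\<close>
    define j where "j n = nat \<lfloor>\<alpha> / t (r n)\<rfloor>" for n
    have "norm (real (j n) * t (r n) - \<alpha>) \<le> t (r n)" for n
    proof -
      let ?x = "\<alpha> / t (r n)"
      have "?x \<ge> 0" using that t(1)[of "r n"] by simp
      then have "real (j n) = of_int \<lfloor>?x\<rfloor>" by (simp add: j_def)
      then have "real (j n) \<le> ?x" "?x \<le> real (j n) + 1" by linarith+
      then have "real (j n) * t (r n) \<le> \<alpha>" "\<alpha> \<le> (real (j n) + 1) * t (r n)"
        using t(1)[of "r n"] by (simp_all add: field_simps)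
      then show ?thesis by (simp add: algebra_simps)
    qed
    then have "(\<lambda>n. real (j n) * t (r n) - \<alpha>) \<longlonglongrightarrow> 0"
      by (intro Lim_null_comparison[OF _ tr0]) simp
    then have "(\<lambda>n. real (j n) * t (r n)) \<longlonglongrightarrow> \<alpha>" by (simp add: LIM_zero_iff)
    moreover have "(\<lambda>n. C (r n)) \<longlonglongrightarrow> D" using D(3) by (simp add: o_def)
    ultimately have lim: "(\<lambda>n. C (r n) ** Rz (real (j n) * t (r n)) ** transpose (C (r n)))
        \<longlonglongrightarrow> D ** Rz \<alpha> ** transpose D"
      by (intro tendsto_intros tendsto_Rz)
    have "C (r n) ** Rz (real (j n) * t (r n)) ** transpose (C (r n)) \<in> G" for n
      by (rule conj_Rz_multiple[OF C CG])
    then have "D ** Rz \<alpha> ** transpose D \<in> G"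
      by (rule closed_sequentially[OF closed _ lim])
    then show ?thesis by (simp add: conj_group_iff[OF rD])
  qed
  have "Rz \<alpha> \<in> conj_group D G" for \<alpha>
  proof (cases "\<alpha> \<ge> 0")
    case False
    have "transpose (Rz (- \<alpha>)) \<in> conj_group D G"
      using False pos rotation_group.transpose_closed[OF rotation_group_conj[OF rD]] by simp
    then show ?thesis by (simp add: transpose_Rz)
  qed (rule pos)
  with rD that show ?thesis by blast
qed

text \<open>The orbit of \<open>e3\<close> contains a spherical cap of fixed height about each of its points, so it is
  open and closed in the sphere.\<close>

lemma (in rotation_group) circle_not_axial:
  assumes circle: "\<And>t. Rz t \<in> G" and A: "A \<in> G" "A *v e3 \<noteq> e3" "A *v e3 \<noteq> - e3"
  shows "G = {A. rotation_matrix A}"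
proof -
  define Orb where "Orb = {B *v e3 | B. B \<in> G}"
  define w where "w = transpose A *v e3"
  have rA: "rotation_matrix A" by (rule rotation[OF A(1)])
  have nw: "norm w = 1"
    by (simp add: w_def rotation_matrix_norm rotation_matrix_transpose rA)
  have height: "x \<bullet> e3 = x $ 3" for x by (simp add: e3_def inner_axis)
  \<comment> \<open>This is the inner product of w with its image under the half-turn
    \<open>Rz pi\<close>. It is below 1 exactly because A moves the axis.\<close>
  define c where "c = 2 * (w$3)\<^sup>2 - 1"
  have nw2: "(w$1)\<^sup>2 + (w$2)\<^sup>2 + (w$3)\<^sup>2 = 1"
    using nw by (simp add: norm_eq_1 inner_vec_def sum_3 power2_eq_square)
  have w3: "w$3 = e3 \<bullet> (A *v e3)"
    by (simp add: w_def height[symmetric] inner_transpose)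
  have "w$3 \<noteq> 1" "w$3 \<noteq> -1"
    using unit_eq_or_minus[of "A *v e3" e3] A(2,3) rA
    by (auto simp: w3 rotation_matrix_norm inner_commute)
  then have "(w$3)\<^sup>2 \<noteq> 1" by (simp add: power2_eq_1_iff)
  moreover have "(w$3)\<^sup>2 \<le> 1" using nw2 by (smt (verit) zero_le_power2)
  ultimately have c1: "c < 1" by (simp add: c_def)
  have cap: "x \<in> Orb" if x: "norm x = 1" "x \<bullet> e3 \<ge> c" for x
  proof -
    \<comment> \<open>A sends w to \<open>e3\<close>, so \<open>h t\<close> is the height of
      \<open>A *v (Rz t *v w)\<close>, a point of the orbit. By continuity every height from c to 1
      occurs, and rotations about \<open>e3\<close> fill each circle of that height.\<close>
    define h where "h t = w \<bullet> (Rz t *v w)" for t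
    have h0: "h 0 = 1" using nw by (simp add: h_def Rz_0 norm_eq_1)
    have hpi: "h pi = c"
      using nw2 by (simp add: h_def Rz_def inner_vec_def matrix_vector_mult_def sum_3 vector_3 c_def power2_eq_square)
    have cont: "continuous_on {0..pi} h"
      unfolding h_def Rz_def inner_vec_def matrix_vector_mult_def sum_3 vec_lambda_beta vector_3 inner_real_def
      by (intro continuous_intros)
    have "x \<bullet> e3 \<le> 1" using norm_cauchy_schwarz[of x e3] x(1) by simp
    then obtain t where t: "h t = x \<bullet> e3" using IVT2'[of h pi "x \<bullet> e3" 0] cont x(2) h0 hpi by auto
    define y where "y = A *v (Rz t *v w)"
    have "y $ 3 = e3 \<bullet> y" by (simp add: height[symmetric] inner_commute)
    also have "\<dots> = h t" by (simp add: y_def h_def w_def inner_transpose)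
    finally have "y $ 3 = x $ 3" using t by (simp add: height)
    moreover have "norm y = 1"
      by (simp add: y_def rotation_matrix_norm rA rotation_matrix_Rz nw)
    ultimately obtain s where "Rz s *v y = x" using Rz_height[of y x] x(1) by blast
    then have "x = (Rz s ** (A ** (Rz t ** transpose A))) *v e3"
      by (simp add: y_def w_def matrix_vector_mul_assoc[symmetric])
    moreover have "Rz s ** (A ** (Rz t ** transpose A)) \<in> G"
      using circle A(1) by (intro mult_closed transpose_closed)
    ultimately show ?thesis unfolding Orb_def by blast
  qed
  have cap2: "x \<in> Orb" if x: "norm x = 1" "x \<bullet> y \<ge> c" and y: "y \<in> Orb" for x y
  proof -
    obtain B where B: "B \<in> G" "y = B *v e3" using y by (auto simp: Orb_def)
    have rB: "rotation_matrix B" by (rule rotation[OF B(1)])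
    have "transpose B *v x \<in> Orb"
    proof (rule cap)
      show "norm (transpose B *v x) = 1"
        by (simp add: rotation_matrix_norm rotation_matrix_transpose rB x)
      show "c \<le> (transpose B *v x) \<bullet> e3" using x(2) B(2) by (simp add: inner_transpose)
    qed
    then obtain D where D: "D \<in> G" "transpose B *v x = D *v e3" by (auto simp: Orb_def)
    then have "x = (B ** D) *v e3"
      using rotation_matrix_inverse(3)[OF rB, of x] by (simp add: matrix_vector_mul_assoc)
    then show ?thesis using mult_closed[OF B(1) D(1)] by (auto simp: Orb_def)
  qed
  have sub: "Orb \<subseteq> sphere 0 1"
    using rotation by (auto simp: Orb_def rotation_matrix_norm)
  have e3O: "e3 \<in> Orb" unfolding Orb_def using one_closed by force
  \<comment> \<open>Stated for a general set closed under caps because, by symmetry of the inner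
    product, the complement of the orbit is closed under caps as well.\<close>
  have op: "openin (top_of_set (sphere 0 1)) S"
    if S: "S \<subseteq> sphere 0 1" "\<And>x y. norm x = 1 \<Longrightarrow> x \<bullet> y \<ge> c \<Longrightarrow> y \<in> S \<Longrightarrow> x \<in> S" for S :: "(real^3) set"
  proof -
    have "S = sphere 0 1 \<inter> (\<Union>y\<in>S. {x. y \<bullet> x > c})"
    proof (intro equalityI subsetI)
      fix x assume "x \<in> S"
      moreover from this S(1) have "x \<bullet> x = 1" by (auto simp: norm_eq_1)
      ultimately show "x \<in> sphere 0 1 \<inter> (\<Union>y\<in>S. {x. y \<bullet> x > c})" using S(1) c1 by (auto intro!: bexI[of _ x])
    next
      fix x assume "x \<in> sphere 0 1 \<inter> (\<Union>y\<in>S. {x. y \<bullet> x > c})"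
      then obtain y where "norm x = 1" "y \<in> S" "y \<bullet> x > c" by auto
      then show "x \<in> S" using S(2)[of x y] by (simp add: inner_commute)
    qed
    moreover have "open (\<Union>y\<in>S. {x. y \<bullet> x > c})"
      by (intro open_UN ballI open_halfspace_gt)
    ultimately show ?thesis by (metis openin_open_Int)
  qed
  have "openin (top_of_set (sphere 0 1)) Orb" using sub cap2 by (rule op)
  moreover have "openin (top_of_set (sphere 0 1)) (sphere 0 1 - Orb)"
  proof (rule op)
    fix x y :: "real^3" assume "norm x = 1" "c \<le> x \<bullet> y" "y \<in> sphere 0 1 - Orb"
    then show "x \<in> sphere 0 1 - Orb" using cap2[of y x] by (auto simp: inner_commute)
  qed auto
  ultimately have "Orb = sphere 0 1"
  proof -
    assume 1: "openin (top_of_set (sphere 0 1)) Orb" and "openin (top_of_set (sphere 0 1)) (sphere 0 1 - Orb)"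
    then have "closedin (top_of_set (sphere 0 1)) Orb"
      using sub by (simp add: closedin_def)
    moreover have "connected (sphere 0 1 :: (real^3) set)" by (rule connected_sphere) simp
    ultimately show ?thesis using 1 e3O connected_clopen by blast
  qed
  show ?thesis
  proof (intro equalityI subsetI)
    fix B :: "real^3^3" assume "B \<in> {A. rotation_matrix A}"
    then have B: "rotation_matrix B" by simp
    then have "B *v e3 \<in> Orb" using \<open>Orb = sphere 0 1\<close> by (simp add: rotation_matrix_norm)
    then obtain D where D: "D \<in> G" "B *v e3 = D *v e3" by (auto simp: Orb_def)
    have "(transpose D ** B) *v e3 = e3"
      using D rotation_matrix_inverse(4)[OF rotation[OF D(1)]] by (simp add: matrix_vector_mul_assoc[symmetric])
    then obtain t where "transpose D ** B = Rz t"
      using rotation_matrix_fix_e3 rotation_matrix_mult rotation_matrix_transpose B rotation[OF D(1)] by metis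
    then have "B = D ** Rz t" by (metis rotation[OF D(1)] rotation_matrix_inverse(5))
    then show "B \<in> G" using mult_closed[OF D(1) circle] by simp
  qed (use rotation in simp)
qed

lemma (in rotation_group) infinite_cases:
  assumes closed: "closed G" and inf: "infinite G"
  shows "(\<exists>k::int. map_group (act ` G) \<cong> map_group (roots_of_unity_maps k)) \<or>
     (\<exists>k::nat. k \<ge> 1 \<and> map_group (act ` G) \<cong> map_group (dihedral_maps k)) \<or>
     map_group (act ` G) \<cong> map_group O1_O2_maps \<or>
     map_group (act ` G) \<cong> map_group sphere_isometries"
proof -
  obtain C where C: "rotation_matrix C" "\<And>t. Rz t \<in> conj_group C G"
    using infinite_contains_circle[OF closed inf] by metis
  interpret H: rotation_group "conj_group C G" by (rule rotation_group_conj[OF C(1)])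
  have iso: "map_group (act ` G) \<cong> map_group (act ` conj_group C G)" by (rule map_group_conj[OF C(1)])
  show ?thesis
  proof (cases "\<forall>A\<in>conj_group C G. A *v e3 = e3 \<or> A *v e3 = - e3")
    case True
    then show ?thesis using H.axial_cases C(2) iso_trans[OF iso] by meson
  next
    case False
    then have "conj_group C G = {A. rotation_matrix A}" using H.circle_not_axial C(2) by blast
    then show ?thesis using iso by (simp add: sphere_isometries_eq)
  qed
qed

section \<open>Poles of finite groups\<close>

definition orb :: "(real^3^3) set \<Rightarrow> real^3 \<Rightarrow> (real^3) set" where
  "orb G x = (\<lambda>A. A *v x) ` G"

definition stab :: "(real^3^3) set \<Rightarrow> real^3 \<Rightarrow> (real^3^3) set" where
  "stab G x = {A \<in> G. A *v x = x}"

definition poles :: "(real^3^3) set \<Rightarrow> (real^3) set" where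
  "poles G = {x. norm x = 1 \<and> (\<exists>A\<in>G. A \<noteq> mat 1 \<and> A *v x = x)}"

lemma even_card_involution:
  assumes "finite X" "\<And>x. x \<in> X \<Longrightarrow> f x \<in> X" "\<And>x. x \<in> X \<Longrightarrow> f (f x) = x" "\<And>x. x \<in> X \<Longrightarrow> f x \<noteq> x"
  shows "even (card X)"
proof -
  let ?C = "(\<lambda>x. {x, f x}) ` X"
  have U: "\<Union>?C = X" using assms(2) by auto
  have "2 dvd card (\<Union>?C)"
  proof (rule dvd_partition)
    show "finite (\<Union>?C)" by (simp only: U assms(1))
    show "\<forall>c\<in>?C. 2 dvd card c"
    proof
      fix c assume "c \<in> ?C"
      then obtain x where "x \<in> X" "c = {x, f x}" by auto
      then have "card c = 2" using assms(4)[of x] by (simp add: card_2_iff)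
      then show "2 dvd card c" by simp
    qed
    show "\<forall>c1\<in>?C. \<forall>c2\<in>?C. c1 \<noteq> c2 \<longrightarrow> c1 \<inter> c2 = {}"
      using assms(3) by (auto; metis)
  qed
  then show ?thesis by (simp only: U)
qed

lemma unit_neq_minus:
  fixes p :: "'a::real_normed_vector"
  assumes "norm p = 1"
  shows "p \<noteq> - p"
proof
  assume "p = - p"
  then have "2 *\<^sub>R p = 0" by (metis add.right_inverse scaleR_2)
  then show False using assms by auto
qed

text \<open>A fixed vector independent of p would make A the identity, so p x s = 0; expanding p x
  (p x s) yields the coefficient.\<close>

lemma fixed_vector:
  fixes A :: "real^3^3"
  assumes "rotation_matrix A" "A \<noteq> mat 1" "A *v p = p" "norm p = 1" "A *v s = s"
  shows "s = (p \<bullet> s) *\<^sub>R p"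
proof -
  have "cross3 p s = 0"
    using rotation_matrix_eqI[OF assms(1) rotation_matrix_mat_1, of p s] assms by auto
  then have "cross3 p (cross3 p s) = 0" by simp
  then have "(p \<bullet> s) *\<^sub>R p - (p \<bullet> p) *\<^sub>R s = 0" by (simp only: Lagrange)
  then show ?thesis using assms(4) by (simp add: norm_eq_1)
qed

context rotation_group
begin

lemma norm_mem: "A \<in> G \<Longrightarrow> norm (A *v x) = norm x"
  by (simp add: rotation rotation_matrix_norm)

lemma inverse_mem:
  "A \<in> G \<Longrightarrow> A *v (transpose A *v x) = x" "A \<in> G \<Longrightarrow> transpose A *v (A *v x) = x"
  by (simp_all add: rotation rotation_matrix_inverse)

lemma orb_self: "x \<in> orb G x"
  unfolding orb_def using one_closed by force

lemma orb_closed: "A \<in> G \<Longrightarrow> y \<in> orb G x \<Longrightarrow> A *v y \<in> orb G x"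
  unfolding orb_def using mult_closed by (auto simp: matrix_vector_mul_assoc)

lemma orb_eq: "y \<in> orb G x \<Longrightarrow> orb G y = orb G x"
proof -
  assume y: "y \<in> orb G x"
  then obtain A where A: "A \<in> G" "y = A *v x" by (auto simp: orb_def)
  have "x \<in> orb G y"
    using A inverse_mem(2)[OF A(1), of x] transpose_closed[OF A(1)] unfolding orb_def by (metis image_eqI)
  then show ?thesis using y orb_closed unfolding orb_def by blast
qed

lemma orb_norm: "y \<in> orb G x \<Longrightarrow> norm y = norm x"
  by (auto simp: orb_def norm_mem)

lemma rotation_group_stab: "rotation_group (stab G x)"
proof
  show "transpose A \<in> stab G x" if "A \<in> stab G x" for A
    using that inverse_mem(2)[of A x] by (simp add: stab_def transpose_closed)
qed (auto simp: stab_def rotation one_closed mult_closed matrix_vector_mul_assoc[symmetric])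

end

locale finite_rotation_group = rotation_group +
  assumes finite_G: "finite G"
begin

lemma finite_orb: "finite (orb G x)"
  by (simp add: orb_def finite_G)

lemma finite_stab: "finite (stab G x)"
  by (simp add: stab_def finite_G)

lemma finite_rotation_group_stab: "finite_rotation_group (stab G x)"
  using rotation_group_stab finite_stab
  by (simp add: finite_rotation_group_def finite_rotation_group_axioms_def)

lemma card_orb_stab: "card (orb G x) * card (stab G x) = card G"
proof -
  have fib: "card {A \<in> G. A *v x = y} = card (stab G x)" if y: "y \<in> orb G x" for y
  proof -
    obtain B where B: "B \<in> G" "y = B *v x" using y by (auto simp: orb_def)
    have "bij_betw (\<lambda>A. B ** A) (stab G x) {A \<in> G. A *v x = y}"
    proof (rule bij_betw_byWitness[where f' = "\<lambda>A. transpose B ** A"])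
      show "(\<lambda>A. B ** A) ` stab G x \<subseteq> {A \<in> G. A *v x = y}"
        using B by (auto simp: stab_def mult_closed matrix_vector_mul_assoc[symmetric])
      show "(\<lambda>A. transpose B ** A) ` {A \<in> G. A *v x = y} \<subseteq> stab G x"
        using B by (auto simp: stab_def mult_closed transpose_closed matrix_vector_mul_assoc[symmetric] inverse_mem)
    qed (use rotation_matrix_inverse[OF rotation[OF B(1)]] in auto)
    then show ?thesis by (simp add: bij_betw_same_card)
  qed
  have "card G = (\<Sum>y\<in>orb G x. \<Sum>A | A \<in> G \<and> A *v x = y. 1)"
    by (subst sum.group) (auto simp: finite_G orb_def)
  also have "\<dots> = (\<Sum>y\<in>orb G x. card (stab G x))" using fib by simp
  finally show ?thesis by simp
qed

lemma card_free_dvd: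
  assumes W: "finite W" "\<And>A x. A \<in> G \<Longrightarrow> x \<in> W \<Longrightarrow> A *v x \<in> W"
    and free: "\<And>A x. A \<in> G \<Longrightarrow> x \<in> W \<Longrightarrow> A *v x = x \<Longrightarrow> A = mat 1"
  shows "x \<in> W \<Longrightarrow> card (orb G x) = card G" "card G dvd card W"
proof -
  have card: "card (orb G x) = card G" if "x \<in> W" for x
  proof -
    have "mat 1 \<in> stab G x" using one_closed by (simp add: stab_def)
    moreover have "A = mat 1" if "A \<in> stab G x" for A
      using free[OF _ \<open>x \<in> W\<close>] that unfolding stab_def by blast
    ultimately have "stab G x = {mat 1}" by blast
    then show ?thesis using card_orb_stab[of x] by simp
  qed
  then show "x \<in> W \<Longrightarrow> card (orb G x) = card G" .
  have U: "\<Union>(orb G ` W) = W" using orb_self W(2) by (auto simp: orb_def)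
  have "card G dvd card (\<Union>(orb G ` W))"
  proof (rule dvd_partition)
    show "\<forall>c1\<in>orb G ` W. \<forall>c2\<in>orb G ` W. c1 \<noteq> c2 \<longrightarrow> c1 \<inter> c2 = {}"
      using orb_eq by blast
  qed (use card W U in auto)
  then show "card G dvd card W" by (simp only: U)
qed

lemma card_fixed:
  assumes A: "A \<in> G" "A \<noteq> mat 1"
  shows "finite {x. norm x = 1 \<and> A *v x = x}" "card {x. norm x = 1 \<and> A *v x = x} = 2"
proof -
  obtain p where p: "norm p = 1" "A *v p = p" using rotation_matrix_axis rotation[OF A(1)] by metis
  have "{x. norm x = 1 \<and> A *v x = x} = {p, - p}"
    using rotation_matrix_two_fixed[OF rotation[OF A(1)] p(2) _ p(1)] A(2) p
    by (auto simp: matrix_vector_mult_uminus)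
  moreover have "p \<noteq> - p" using unit_neq_minus[OF p(1)] .
  ultimately show "finite {x. norm x = 1 \<and> A *v x = x}" "card {x. norm x = 1 \<and> A *v x = x} = 2"
    by simp_all
qed

lemma finite_poles: "finite (poles G)"
proof -
  have "poles G = (\<Union>A\<in>G - {mat 1}. {x. norm x = 1 \<and> A *v x = x})" by (auto simp: poles_def)
  then show ?thesis using card_fixed(1) finite_G by simp
qed

lemma pole_orb_subset: "x \<in> poles G \<Longrightarrow> orb G x \<subseteq> poles G"
proof
  fix y assume x: "x \<in> poles G" and "y \<in> orb G x"
  then obtain B where B: "B \<in> G" "y = B *v x" by (auto simp: orb_def)
  obtain A where A: "A \<in> G" "A \<noteq> mat 1" "A *v x = x" "norm x = 1" using x by (auto simp: poles_def)
  let ?A = "B ** A ** transpose B"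
  have "?A \<in> G" using A B by (intro mult_closed transpose_closed)
  moreover have "?A *v y = y"
    by (simp add: B(2) matrix_vector_mul_assoc[symmetric] inverse_mem B(1) A(3))
  moreover have "?A \<noteq> mat 1"
  proof
    assume "?A = mat 1"
    then have "transpose B ** ?A ** B = mat 1" by (simp add: rotation_matrix_inverse[OF rotation[OF B(1)]])
    then show False using A(2) conj_rotation_cancel(2)[OF rotation[OF B(1)]] by simp
  qed
  ultimately show "y \<in> poles G" using A(4) B by (auto simp: poles_def norm_mem)
qed

lemma stab_pole:
  assumes "x \<in> poles G"
  shows "card (stab G x) \<ge> 2"
proof -
  obtain A where A: "A \<in> G" "A \<noteq> mat 1" "A *v x = x" using assms by (auto simp: poles_def)
  then have "{mat 1, A} \<subseteq> stab G x" using one_closed by (auto simp: stab_def)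
  then show ?thesis using card_mono[OF finite_stab, of "{mat 1, A}" x] A(2) by simp
qed

text \<open>Counts the pairs of a nontrivial rotation and one of its fixed points in two ways.\<close>

lemma pole_count: "2 * (int (card G) - 1) = (\<Sum>Q\<in>orb G ` poles G. int (card G) - int (card Q))"
proof -
  have "2 * (int (card G) - 1) = (\<Sum>A\<in>G - {mat 1}. int (card {x. norm x = 1 \<and> A *v x = x}))"
    using card.remove[OF finite_G one_closed] by (simp add: card_fixed(2))
  also have "\<dots> = (\<Sum>A\<in>G - {mat 1}. \<Sum>x\<in>poles G. if A *v x = x then 1 else 0)"
  proof (rule sum.cong[OF refl])
    fix A assume "A \<in> G - {mat 1}"
    then have "{x. norm x = 1 \<and> A *v x = x} = {x \<in> poles G. A *v x = x}" by (auto simp: poles_def)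
    then show "int (card {x. norm x = 1 \<and> A *v x = x}) = (\<Sum>x\<in>poles G. if A *v x = x then 1 else 0)"
      using finite_poles by (simp add: sum.If_cases Int_def)
  qed
  also have "\<dots> = (\<Sum>x\<in>poles G. \<Sum>A\<in>G - {mat 1}. if A *v x = x then 1 else 0)"
    by (rule sum.swap)
  also have "\<dots> = (\<Sum>x\<in>poles G. int (card (stab G x)) - 1)"
  proof (rule sum.cong[OF refl])
    fix x assume x: "x \<in> poles G"
    have "(G - {mat 1}) \<inter> {A. A *v x = x} = stab G x - {mat 1}" by (auto simp: stab_def)
    moreover have "mat 1 \<in> stab G x" using one_closed by (simp add: stab_def)
    ultimately show "(\<Sum>A\<in>G - {mat 1}. if A *v x = x then 1 else 0) = int (card (stab G x)) - 1"
      using finite_G finite_stab[of x] stab_pole[OF x] by (simp add: sum.If_cases of_nat_diff)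
  qed
  also have "\<dots> = (\<Sum>Q\<in>orb G ` poles G. \<Sum>x | x \<in> poles G \<and> orb G x = Q. int (card (stab G x)) - 1)"
    by (rule sum.group[symmetric]) (auto simp: finite_poles)
  \<comment> \<open>Stabilizers along an orbit Q have equal order n with n |Q| = |G|, so Q
    contributes |Q| (n - 1) = |G| - |Q|.\<close>
  also have "\<dots> = (\<Sum>Q\<in>orb G ` poles G. int (card G) - int (card Q))"
  proof (rule sum.cong[OF refl])
    fix Q assume "Q \<in> orb G ` poles G"
    then obtain y where y: "y \<in> poles G" "Q = orb G y" by auto
    have Q: "{x. x \<in> poles G \<and> orb G x = Q} = Q"
      using y pole_orb_subset orb_eq orb_self by blast
    have "card (stab G x) = card (stab G y)" if "x \<in> Q" for x
    proof -
      have "orb G x = orb G y" using that y(2) orb_eq by simp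
      moreover have "card (orb G y) > 0" using finite_orb orb_self card_gt_0_iff by blast
      ultimately show ?thesis
        using card_orb_stab[of x] card_orb_stab[of y] by (metis mult_cancel1 not_gr0)
    qed
    then have "(\<Sum>x\<in>Q. int (card (stab G x)) - 1) = int (card Q) * (int (card (stab G y)) - 1)" by simp
    also have "\<dots> = int (card G) - int (card Q)"
      using card_orb_stab[of y] by (simp add: y(2) right_diff_distrib flip: of_nat_mult)
    finally show "(\<Sum>x | x \<in> poles G \<and> orb G x = Q. int (card (stab G x)) - 1) = int (card G) - int (card Q)"
      unfolding Q .
  qed
  finally show ?thesis .
qed

end

text \<open>Dividing by N, the sum condition reads 1/l + 1/m + 1/n = 1 + 2/N, as for spherical
  triangle groups. The type (2, 2, n) gives c = 2; the types (2, 3, 3), (2, 3, 4) and (2, 3, 5) have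
  N = 12, 24, 60 and give the three listed pairs.\<close>

lemma triangle_numbers_sorted:
  fixes a b c N l m n :: nat
  assumes eq: "a * l = N" "b * m = N" "c * n = N" and le: "2 \<le> l" "l \<le> m" "m \<le> n"
    and sum: "a + b + c = N + 2"
  shows "c \<le> 2 \<or> (c, n) \<in> {(4, 3), (6, 4), (12, 5)}"
proof -
  have mul: "k * x \<le> N" if "x * y = N" "k \<le> y" for k x y
    using that by (metis mult.commute mult_le_mono1)
  \<comment> \<open>The bounds 3, 4 and 6 used for l, m and n are the Euclidean borderlines 1/3 +
    1/3 + 1/3, 1/2 + 1/4 + 1/4 and 1/2 + 1/3 + 1/6, where the orbit sizes would add up to at most
    N.\<close>
  have "l = 2"
  proof (rule ccontr)
    assume "l \<noteq> 2"
    then show False using mul[OF eq(1), of 3] mul[OF eq(2), of 3] mul[OF eq(3), of 3] le sum by linarith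
  qed
  then have a: "2 * a = N" using eq by simp
  have "m \<le> 3"
  proof (rule ccontr)
    assume "\<not> m \<le> 3"
    then show False using a mul[OF eq(2), of 4] mul[OF eq(3), of 4] le sum by linarith
  qed
  then consider "m = 2" | "m = 3" using le by linarith
  then show ?thesis
  proof cases
    case 1
    then show ?thesis using a eq(2) sum by simp
  next
    case 2
    then have b: "3 * b = N" using eq by simp
    have "n \<le> 5"
    proof (rule ccontr)
      assume "\<not> n \<le> 5"
      then show False using a b mul[OF eq(3), of 6] sum by linarith
    qed
    then consider "n = 3" | "n = 4" | "n = 5" using 2 le by linarith
    then show ?thesis using a b eq(3) sum by cases auto
  qed
qed

lemma triangle_numbers:
  fixes a b c N l m n :: nat
  assumes "a * l = N" "b * m = N" "c * n = N" "2 \<le> l" "2 \<le> m" "2 \<le> n" "a + b + c = N + 2"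
  shows "\<exists>(x, y)\<in>{(a, l), (b, m), (c, n)}. x \<le> 2 \<or> (x, y) \<in> {(4, 3), (6, 4), (12, 5)}"
proof -
  consider "l \<le> m" "m \<le> n" | "l \<le> n" "n \<le> m" | "m \<le> l" "l \<le> n" | "m \<le> n" "n \<le> l" | "n \<le> l" "l \<le> m" | "n \<le> m" "m \<le> l"
    by linarith
  then have "(c \<le> 2 \<or> (c, n) \<in> {(4, 3), (6, 4), (12, 5)}) \<or>
    (b \<le> 2 \<or> (b, m) \<in> {(4, 3), (6, 4), (12, 5)}) \<or> (a \<le> 2 \<or> (a, l) \<in> {(4, 3), (6, 4), (12, 5)})"
    using triangle_numbers_sorted[of a l N b m c n] triangle_numbers_sorted[of a l N c n b m]
      triangle_numbers_sorted[of b m N a l c n] triangle_numbers_sorted[of b m N c n a l]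
      triangle_numbers_sorted[of c n N a l b m] triangle_numbers_sorted[of c n N b m a l] assms
    by cases auto
  then show ?thesis by blast
qed

text \<open>In the pole count each orbit contributes at least N/2 and at most N - 1 to a total of 2N
  - 2, so there are two or three orbits.\<close>

lemma (in finite_rotation_group) pole_types:
  assumes "G \<noteq> {mat 1}"
  obtains v where "v \<in> poles G" "card (orb G v) \<le> 2 \<or> (card (orb G v), card (stab G v)) \<in> {(4, 3), (6, 4), (12, 5)}"
proof -
  let ?N = "card G"
  let ?\<Omega> = "orb G ` poles G"
  have "{mat 1} \<subset> G" using assms one_closed by blast
  then have "card {mat 1 :: real^3^3} < ?N" by (rule psubset_card_mono[OF finite_G])
  then have N: "?N \<ge> 2" by simp
  have fin: "finite ?\<Omega>" using finite_poles by simp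
  have half: "2 * card Q \<le> ?N" "card Q \<ge> 1" if Q: "Q \<in> ?\<Omega>" for Q
  proof -
    obtain x where x: "x \<in> poles G" "Q = orb G x" using Q by auto
    have "2 * card (orb G x) \<le> card (stab G x) * card (orb G x)"
      using stab_pole[OF x(1)] by (rule mult_le_mono1)
    then show "2 * card Q \<le> ?N" using card_orb_stab[of x] by (simp add: x(2) mult.commute)
    show "card Q \<ge> 1" using orb_self[of x] finite_orb[of x] by (auto simp: x(2) Suc_le_eq card_gt_0_iff)
  qed
  have "2 * (2 * (int ?N - 1)) = (\<Sum>Q\<in>?\<Omega>. 2 * (int ?N - int (card Q)))"
    unfolding pole_count by (simp add: sum_distrib_left)
  also have "\<dots> \<ge> (\<Sum>Q\<in>?\<Omega>. int ?N)"
    by (rule sum_mono) (use half in force)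
  finally have "int (card ?\<Omega>) * int ?N \<le> 4 * int ?N - 4" by simp
  then have "int (card ?\<Omega>) * int ?N < 4 * int ?N" by linarith
  then have lt4: "card ?\<Omega> < 4" using N by (simp add: mult_less_cancel_right)
  have "2 * (int ?N - 1) \<le> (\<Sum>Q\<in>?\<Omega>. int ?N - 1)"
    unfolding pole_count by (rule sum_mono) (use half in force)
  then have le: "2 * (int ?N - 1) \<le> int (card ?\<Omega>) * (int ?N - 1)" by simp
  have ge2: "card ?\<Omega> \<ge> 2"
  proof (rule ccontr)
    assume "\<not> ?thesis"
    then have "int (card ?\<Omega>) * (int ?N - 1) \<le> 1 * (int ?N - 1)"
      using N by (intro mult_right_mono) auto
    with le have "2 * (int ?N - 1) \<le> 1 * (int ?N - 1)" by (rule order_trans)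
    then show False using N by simp
  qed
  consider "card ?\<Omega> = 2" | "card ?\<Omega> = 3" using lt4 ge2 by linarith
  then show ?thesis
  proof cases
    case 1
    then obtain P Q where PQ: "?\<Omega> = {P, Q}" "P \<noteq> Q" by (auto simp: card_2_iff)
    \<comment> \<open>With two orbits the pole count collapses to this equation: the group fixes
      both ends of an axis.\<close>
    then have "card P + card Q = 2" using pole_count by simp
    moreover obtain x where "x \<in> poles G" "P = orb G x" using PQ(1) by blast
    ultimately show ?thesis using that[of x] by simp
  next
    case 2
    then obtain P Q S where PQ: "?\<Omega> = {P, Q, S}" "P \<noteq> Q" "Q \<noteq> S" "P \<noteq> S"
      by (auto simp: card_3_iff)
    then have "2 * (int ?N - 1) = (int ?N - card P) + (int ?N - card Q) + (int ?N - card S)"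
      using pole_count by simp
    moreover have "p + q + s = n + 2"
      if "2 * (int n - 1) = (int n - int p) + (int n - int q) + (int n - int s)" for n p q s :: nat
      using that by presburger
    ultimately have sum: "card P + card Q + card S = ?N + 2" by blast
    obtain x where x: "x \<in> poles G" "P = orb G x" using PQ(1) by blast
    obtain y where y: "y \<in> poles G" "Q = orb G y" using PQ(1) by blast
    obtain z where z: "z \<in> poles G" "S = orb G z" using PQ(1) by blast
    show ?thesis
      using triangle_numbers[OF card_orb_stab[of x] card_orb_stab[of y] card_orb_stab[of z]
          stab_pole[OF x(1)] stab_pole[OF y(1)] stab_pole[OF z(1)]] sum x y z that
      by (auto)
  qed
qed

section \<open>Polyhedral groups\<close>

text \<open>Balls are strictly convex, so a hull point at maximal distance r is extreme, and extreme
  points of a hull lie in the generating set.\<close>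

lemma convex_hull_Int_sphere:
  fixes S :: "'a::euclidean_space set"
  assumes "S \<subseteq> sphere 0 r" "x \<in> convex hull S" "norm x = r"
  shows "x \<in> S"
proof -
  have sub: "convex hull S \<subseteq> cball 0 r"
    using assms(1) by (intro hull_minimal) (auto simp: convex_cball)
  have "x extreme_point_of convex hull S"
    unfolding extreme_point_of_def
  proof (intro conjI ballI notI)
    fix a b assume ab: "a \<in> convex hull S" "b \<in> convex hull S" "x \<in> open_segment a b"
    have "dist 0 x < max (dist 0 a) (dist 0 b)"
      using ab(3) by (metis dist_commute dist_decreases_open_segment less_max_iff_disj)
    moreover have "dist 0 a \<le> r" "dist 0 b \<le> r" using ab(1,2) sub by auto
    ultimately show False using assms(3) by simp
  qed (rule assms(2))
  then show ?thesis by (rule extreme_point_of_convex_hull)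
qed

text \<open>The vertices are exactly the points of the solid at distance r from the origin, and an
  orthogonal map preserves this distance.\<close>

lemma orthogonal_transformation_convex_hull:
  fixes S :: "'a::euclidean_space set"
  assumes f: "orthogonal_transformation f" and S: "S \<subseteq> sphere 0 r"
  shows "f ` (convex hull S) = convex hull S \<longleftrightarrow> f ` S = S"
proof
  assume "f ` S = S"
  then show "f ` (convex hull S) = convex hull S"
    using f by (simp add: convex_hull_linear_image orthogonal_transformation_def)
next
  assume eq: "f ` (convex hull S) = convex hull S"
  have norm: "norm (f x) = norm x" for x using f by (simp add: orthogonal_transformation)
  show "f ` S = S"
  proof (intro equalityI subsetI)
    fix y assume "y \<in> f ` S"
    then obtain x where x: "x \<in> S" "y = f x" by auto
    then have "y \<in> convex hull S" using eq hull_inc[of x S convex] by blast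
    moreover have "norm y = r" using x S by (auto simp: norm)
    ultimately show "y \<in> S" using convex_hull_Int_sphere S by blast
  next
    fix y assume y: "y \<in> S"
    then obtain x where x: "x \<in> convex hull S" "y = f x" using eq hull_inc[of y S convex] by blast
    have "norm x = norm y" by (simp add: x norm)
    then have "norm x = r" using y S by auto
    then show "y \<in> f ` S" using convex_hull_Int_sphere[OF S x(1)] x(2) by blast
  qed
qed

text \<open>Transitivity on the pairs with inner product \<open>v \<bullet> u\<close> makes \<open>G\<close> the full rotation group of \<open>V\<close>,
  because a rotation is determined by the images of \<open>v\<close> and \<open>u\<close>.\<close>

lemma (in rotation_group) polyhedron_iso:
  assumes norm: "\<And>x. x \<in> V \<Longrightarrow> norm x = 1"
    and inv: "\<And>A x. A \<in> G \<Longrightarrow> x \<in> V \<Longrightarrow> A *v x \<in> V"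
    and vu: "v \<in> V" "u \<in> V" "cross3 v u \<noteq> 0"
    and flag: "\<And>x y. x \<in> V \<Longrightarrow> y \<in> V \<Longrightarrow> x \<bullet> y = v \<bullet> u \<Longrightarrow> \<exists>A\<in>G. A *v v = x \<and> A *v u = y"
    and T: "orthogonal_matrix T" and \<rho>: "\<rho> > 0" and S: "(\<lambda>x. \<rho> *\<^sub>R (T *v x)) ` V = S"
  shows "map_group (act ` G) \<cong> map_group (rotational_symmetries (convex hull S))"
proof -
  have TT: "T ** transpose T = mat 1" "transpose T ** T = mat 1"
    using T by (auto simp: orthogonal_matrix_def)
  have TTv: "T *v (transpose T *v x) = x" "transpose T *v (T *v x) = x" for x
    by (simp_all add: matrix_vector_mul_assoc TT)
  have TTm: "T ** (transpose T ** B) = B" "transpose T ** (T ** B) = B" for B :: "real^3^3"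
    by (simp_all add: matrix_mul_assoc TT)
  have detT: "det T * det T = 1"
  proof -
    have "det (T ** transpose T) = 1" by (simp add: TT det_I)
    then show ?thesis by (simp add: det_mul)
  qed
  have normT: "norm (T *v x) = norm x" for x
  proof -
    have "(T *v x) \<bullet> (T *v x) = x \<bullet> (transpose T *v (T *v x))"
      by (metis inner_transpose inner_commute)
    then show ?thesis by (simp add: norm_eq_sqrt_inner TTv)
  qed
  have Sr: "S \<subseteq> sphere 0 \<rho>" using \<rho> norm by (auto simp: S[symmetric] normT)
  define cj where "cj A = T ** A ** transpose T" for A
  \<comment> \<open>T may reverse orientation, but it enters the determinant of the conjugate
    twice.\<close>
  have rot: "rotation_matrix (cj A) \<longleftrightarrow> rotation_matrix A" for A
  proof
    assume "rotation_matrix A"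
    then show "rotation_matrix (cj A)"
      using T detT by (simp add: cj_def rotation_matrix_def orthogonal_matrix_mul det_mul)
  next
    assume *: "rotation_matrix (cj A)"
    have "A = transpose T ** cj A ** T" by (simp add: cj_def matrix_mul_assoc[symmetric] TT TTm)
    moreover have "rotation_matrix (transpose T ** cj A ** T)"
      using * T detT by (simp add: rotation_matrix_def orthogonal_matrix_mul det_mul)
    ultimately show "rotation_matrix A" by simp
  qed
  have cjS: "(*v) (cj A) ` S = S \<longleftrightarrow> (*v) A ` V = V" for A
  proof -
    have "(*v) (cj A) ` S = (\<lambda>x. \<rho> *\<^sub>R (T *v x)) ` ((*v) A ` V)"
      by (auto simp: S[symmetric] image_image cj_def matrix_vector_mul_assoc[symmetric]
          matrix_vector_mult_scaleR TTv)
    moreover have "inj (\<lambda>x. \<rho> *\<^sub>R (T *v x))"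
      using \<rho> by (intro injI) (metis TTv(2) less_irrefl scaleR_left_imp_eq)
    ultimately show ?thesis unfolding S[symmetric] by (simp add: inj_image_eq_iff)
  qed
  have GV: "(*v) A ` V = V" if A: "A \<in> G" for A
  proof (intro equalityI subsetI)
    fix x assume "x \<in> V"
    then have "transpose A *v x \<in> V" using inv transpose_closed[OF A] by blast
    then show "x \<in> (*v) A ` V" using inverse_mem(1)[OF A, of x] by (metis image_eqI)
  qed (use inv A in auto)
  let ?\<beta> = "\<lambda>A. (*v) (cj A)"
  have mv_eq: "A = B" if "(*v) A = (*v) B" for A B :: "real^3^3"
    using that by (metis matrix_of_matrix_vector_mul)
  have "map_group (act ` G) \<cong> map_group (?\<beta> ` G)"
  proof (rule act_iso)
    show "bij (?\<beta> A)" if "A \<in> G" for A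
    proof (rule o_bij)
      have r: "rotation_matrix (cj A)" using rotation[OF that] by (simp add: rot)
      show "(*v) (transpose (cj A)) \<circ> (*v) (cj A) = id" "(*v) (cj A) \<circ> (*v) (transpose (cj A)) = id"
        by (simp_all add: fun_eq_iff rotation_matrix_inverse[OF r])
    qed
    show "inj_on ?\<beta> G"
    proof (rule inj_onI)
      fix A B assume "(*v) (cj A) = (*v) (cj B)"
      then have "transpose T ** cj A ** T = transpose T ** cj B ** T" by (simp add: mv_eq[of "cj A" "cj B"])
      then show "A = B" by (simp add: cj_def matrix_mul_assoc[symmetric] TT TTm)
    qed
    show "?\<beta> (A ** B) = ?\<beta> A \<circ> ?\<beta> B" for A B
      by (simp add: fun_eq_iff cj_def matrix_vector_mul_assoc[symmetric] TTv)
  qed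
  moreover have "?\<beta> ` G = rotational_symmetries (convex hull S)"
  proof (intro equalityI subsetI)
    fix f assume "f \<in> ?\<beta> ` G"
    then obtain A where A: "A \<in> G" "f = (*v) (cj A)" by auto
    have r: "rotation_matrix (cj A)" using rotation[OF A(1)] by (simp add: rot)
    have f: "orthogonal_transformation f" "det (matrix f) = 1"
      using r by (simp_all add: A(2) orthogonal_transformation_matrix rotation_matrix_def)
    then show "f \<in> rotational_symmetries (convex hull S)"
      using GV[OF A(1)] by (simp add: rotational_symmetries_def
          orthogonal_transformation_convex_hull[OF f(1) Sr]) (simp add: A(2) cjS)
  next
    fix f assume "f \<in> rotational_symmetries (convex hull S)"
    then have f: "orthogonal_transformation f" "det (matrix f) = 1"
      and "f ` (convex hull S) = convex hull S"
      by (auto simp: rotational_symmetries_def)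
    then have fS: "f ` S = S" using orthogonal_transformation_convex_hull[OF f(1) Sr] by simp
    define A where "A = transpose T ** matrix f ** T"
    have cjA: "cj A = matrix f" by (simp add: cj_def A_def matrix_mul_assoc[symmetric] TT TTm)
    have fA: "f = (*v) (cj A)"
      unfolding cjA using f(1) by (auto simp: orthogonal_transformation_def intro!: matrix_vector_mul)
    have "rotation_matrix (cj A)"
      using f(1,2) by (simp add: cjA rotation_matrix_def orthogonal_transformation_matrix)
    then have rA: "rotation_matrix A" by (simp add: rot)
    have AV: "(*v) A ` V = V" using fS by (simp add: fA cjS)
    then obtain B where B: "B \<in> G" "B *v v = A *v v" "B *v u = A *v u"
      using flag[of "A *v v" "A *v u"] vu(1,2) by (auto simp: rotation_matrix_inner[OF rA])
    have "A = B" using rotation_matrix_eqI[OF rA rotation[OF B(1)] _ _ vu(3)] B by simp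
    then show "f \<in> ?\<beta> ` G" using B(1) fA by simp
  qed
  ultimately show ?thesis by simp
qed

text \<open>The quantity in \<open>nz\<close> is the Gram determinant of the triple, so the vectors
  form a basis. Two bases with the same Gram matrix differ by an orthogonal map; dividing by \<rho>
  brings the second triple to unit length.\<close>

lemma equiangular_triple:
  fixes v0 v1 v2 :: "real^3"
  assumes n: "norm v0 = 1" "norm v1 = 1" "norm v2 = 1"
    and c: "v0 \<bullet> v1 = c" "v0 \<bullet> v2 = c" "v1 \<bullet> v2 = c"
    and nz: "1 + 2 * c ^ 3 - 3 * c\<^sup>2 \<noteq> 0"
  shows "d \<bullet> v0 = 0 \<Longrightarrow> d \<bullet> v1 = 0 \<Longrightarrow> d \<bullet> v2 = 0 \<Longrightarrow> d = 0"
    and "\<lbrakk>\<rho> > 0; w0 \<bullet> w0 = \<rho>\<^sup>2; w1 \<bullet> w1 = \<rho>\<^sup>2; w2 \<bullet> w2 = \<rho>\<^sup>2;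
      w0 \<bullet> w1 = c * \<rho>\<^sup>2; w0 \<bullet> w2 = c * \<rho>\<^sup>2; w1 \<bullet> w2 = c * \<rho>\<^sup>2\<rbrakk> \<Longrightarrow>
      \<exists>T. orthogonal_matrix T \<and> \<rho> *\<^sub>R (T *v v0) = w0 \<and> \<rho> *\<^sub>R (T *v v1) = w1 \<and> \<rho> *\<^sub>R (T *v v2) = w2"
proof -
  define M :: "real^3 \<Rightarrow> real^3 \<Rightarrow> real^3 \<Rightarrow> real^3^3" where "M a b e = vector [a, b, e]" for a b e
  define Gr :: "real^3^3" where "Gr = vector [vector [1, c, c], vector [c, 1, c], vector [c, c, 1]]"
  have gram: "M a b e ** transpose (M a b e) = Gr"
    if "a \<bullet> a = 1" "b \<bullet> b = 1" "e \<bullet> e = 1" "a \<bullet> b = c" "a \<bullet> e = c" "b \<bullet> e = c" for a b e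
  proof -
    have "M x y z ** transpose (M x y z) = vector [vector [x \<bullet> x, x \<bullet> y, x \<bullet> z],
        vector [y \<bullet> x, y \<bullet> y, y \<bullet> z], vector [z \<bullet> x, z \<bullet> y, z \<bullet> z]]" for x y z
      by (simp add: M_def vec_eq_iff forall_3 matrix_matrix_mult_def transpose_def vector_3 inner_vec_def)
    then show ?thesis using that by (simp add: Gr_def inner_commute)
  qed
  have col: "transpose (M a b e) *v axis 1 1 = a" "transpose (M a b e) *v axis 2 1 = b"
    "transpose (M a b e) *v axis 3 1 = e" for a b e
    by (simp_all add: matrix_vector_mult_basis column_def transpose_def M_def vec_eq_iff vector_3)
  define X where "X = M v0 v1 v2"
  have X: "X ** transpose X = Gr"
    unfolding X_def using n c by (intro gram) (simp_all add: norm_eq_1)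
  have "det Gr = 1 + 2 * c ^ 3 - 3 * c\<^sup>2"
    by (simp add: Gr_def det_3 vector_3 power2_eq_square power3_eq_cube algebra_simps)
  then have "det X \<noteq> 0" using nz arg_cong[OF X, of det] by (auto simp: det_mul)
  then obtain X' where X': "X ** X' = mat 1" "X' ** X = mat 1"
    using invertible_det_nz[of X] unfolding invertible_def by blast
  show "d = 0" if "d \<bullet> v0 = 0" "d \<bullet> v1 = 0" "d \<bullet> v2 = 0"
  proof -
    have "X *v d = 0"
      using that by (simp add: X_def M_def vec_eq_iff forall_3 vector_3 matrix_vector_mult_def inner_vec_def mult.commute)
    then have "X' *v (X *v d) = 0" by simp
    then show ?thesis by (simp add: matrix_vector_mul_assoc X')
  qed
  show "\<exists>T. orthogonal_matrix T \<and> \<rho> *\<^sub>R (T *v v0) = w0 \<and> \<rho> *\<^sub>R (T *v v1) = w1 \<and> \<rho> *\<^sub>R (T *v v2) = w2"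
    if \<rho>: "\<rho> > 0" and w: "w0 \<bullet> w0 = \<rho>\<^sup>2" "w1 \<bullet> w1 = \<rho>\<^sup>2" "w2 \<bullet> w2 = \<rho>\<^sup>2"
      "w0 \<bullet> w1 = c * \<rho>\<^sup>2" "w0 \<bullet> w2 = c * \<rho>\<^sup>2" "w1 \<bullet> w2 = c * \<rho>\<^sup>2"
  proof -
    define Y where "Y = M (w0 /\<^sub>R \<rho>) (w1 /\<^sub>R \<rho>) (w2 /\<^sub>R \<rho>)"
    have Y: "Y ** transpose Y = Gr"
      unfolding Y_def using \<rho> w by (intro gram) (auto simp: power2_eq_square field_simps)
    \<comment> \<open>The columns of \<open>transpose X\<close> and \<open>transpose Y\<close> are
      the two triples, so the first times T must give the second, which determines T. Orthogonality
      is the equality of the Gram matrices.\<close>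
    define T where "T = transpose Y ** transpose X'"
    have "transpose T ** T = X' ** (Y ** transpose Y) ** transpose X'"
      by (simp add: T_def matrix_transpose_mul matrix_mul_assoc)
    also have "\<dots> = (X' ** X) ** transpose (X' ** X)"
      unfolding Y X[symmetric] by (simp add: matrix_transpose_mul matrix_mul_assoc)
    finally have "transpose T ** T = mat 1" by (simp add: X')
    then have "orthogonal_matrix T" by (simp add: orthogonal_matrix)
    moreover have "T ** transpose X = transpose Y ** transpose (X ** X')"
      by (simp add: T_def matrix_transpose_mul matrix_mul_assoc)
    then have TX: "T ** transpose X = transpose Y" by (simp add: X')
    have "T *v (transpose X *v z) = transpose Y *v z" for z by (simp add: matrix_vector_mul_assoc TX)
    then have "T *v v0 = w0 /\<^sub>R \<rho>" "T *v v1 = w1 /\<^sub>R \<rho>" "T *v v2 = w2 /\<^sub>R \<rho>"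
      using col unfolding X_def Y_def by metis+
    ultimately show ?thesis using \<rho> by (intro exI[of _ T]) simp
  qed
qed

section \<open>Neighbours of a point in the orbit of a pole\<close>

context finite_rotation_group
begin

lemma card_minus_axis:
  assumes "norm v = 1"
  shows "card (orb G v - {v, - v}) = card (orb G v) - (if - v \<in> orb G v then 2 else 1)"
proof (cases "- v \<in> orb G v")
  case True
  then have "card (orb G v - {v, - v}) = card (orb G v) - card {v, - v}"
    using orb_self by (intro card_Diff_subset) auto
  then show ?thesis using True unit_neq_minus[OF assms] by simp
next
  case False
  then have "orb G v - {v, - v} = orb G v - {v}" by auto
  then show ?thesis using False orb_self by simp
qed

lemma stab_free:
  assumes v: "v \<in> poles G" and A: "A \<in> stab G v" and x: "x \<in> orb G v - {v, - v}" "A *v x = x"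
  shows "A = mat 1"
  using rotation_matrix_two_fixed[of A v x] assms orb_norm[of x v] rotation
  by (auto simp: stab_def poles_def)

text \<open>The stabilizer of v acts freely off its axis, so all orbits there have full size. The
  resulting divisibility decides whether -v lies in the orbit: 3 divides 4 - 1, while 4 divides 6 -
  2 and 5 divides 12 - 2.\<close>

lemma pole_neighbours:
  assumes v: "v \<in> poles G"
  shows "card (stab G v) dvd card (orb G v - {v, - v})"
    and "x \<in> orb G v - {v, - v} \<Longrightarrow> card (orb (stab G v) x) = card (stab G v)"
    and "x \<in> orb G v - {v, - v} \<Longrightarrow> orb (stab G v) x \<subseteq> orb G v - {v, - v}"
proof -
  interpret H: finite_rotation_group "stab G v" by (rule finite_rotation_group_stab)
  let ?W = "orb G v - {v, - v}"
  have fin: "finite ?W" using finite_orb by simp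
  have closed: "A *v x \<in> ?W" if A: "A \<in> stab G v" and x: "x \<in> ?W" for A x
  proof -
    have A': "A \<in> G" "A *v v = v" using A by (auto simp: stab_def)
    have "x = v" if "A *v x = v" using inverse_mem(2)[OF A'(1)] that A'(2) by metis
    moreover have "x = - v" if "A *v x = - v"
      using inverse_mem(2)[OF A'(1)] that A'(2) by (metis matrix_vector_mult_uminus)
    ultimately show ?thesis using x orb_closed[OF A'(1)] by blast
  qed
  have free: "A = mat 1" if A: "A \<in> stab G v" and x: "x \<in> ?W" "A *v x = x" for A x
    using stab_free[OF v A x] .
  show "card (stab G v) dvd card ?W" by (rule H.card_free_dvd(2)[OF fin closed free])
  show "x \<in> ?W \<Longrightarrow> card (orb (stab G v) x) = card (stab G v)"
    by (rule H.card_free_dvd(1)[OF fin closed free])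
  show "orb (stab G v) x \<subseteq> ?W" if x: "x \<in> ?W"
    using closed[OF _ x] by (subst orb_def) (rule image_subsetI)
qed

lemma stab_orb_inner:
  assumes "y \<in> orb (stab G v) x"
  shows "v \<bullet> y = v \<bullet> x"
proof -
  obtain A where A: "A \<in> G" "A *v v = v" "y = A *v x" using assms by (auto simp: orb_def stab_def)
  then show ?thesis using rotation_matrix_inner[OF rotation[OF A(1)], of v x] by simp
qed

text \<open>Every pair of orbit points is carried to a pair starting at v, so the inner products
  with v account for all inner products.\<close>

lemma pair_transfer:
  assumes x: "x \<in> orb G v" and y: "y \<in> orb G v"
  obtains A z where "A \<in> G" "x = A *v v" "y = A *v z" "z \<in> orb G v" "v \<bullet> z = x \<bullet> y"
proof -
  obtain A where A: "A \<in> G" "x = A *v v" using x by (auto simp: orb_def)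
  have "transpose A *v y \<in> orb G v" using orb_closed transpose_closed A(1) y by blast
  moreover have "v \<bullet> (transpose A *v y) = x \<bullet> y" unfolding A(2) by (metis inner_commute inner_transpose)
  ultimately show ?thesis using that[OF A, of "transpose A *v y"] A(1) by (simp add: inverse_mem)
qed

lemma flag_transitive:
  assumes x: "x \<in> orb G v" and y: "y \<in> orb G v" and xy: "x \<bullet> y = v \<bullet> u"
    and u: "\<And>z. z \<in> orb G v \<Longrightarrow> v \<bullet> z = v \<bullet> u \<Longrightarrow> z \<in> orb (stab G v) u"
  shows "\<exists>A\<in>G. A *v v = x \<and> A *v u = y"
proof -
  obtain A z where A: "A \<in> G" "x = A *v v" "y = A *v z" and z: "z \<in> orb G v" "v \<bullet> z = x \<bullet> y"
    using pair_transfer[OF x y] by metis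
  obtain B where B: "B \<in> G" "B *v v = v" "z = B *v u"
    using u[OF z(1)] z(2) xy by (auto simp: orb_def stab_def)
  show ?thesis
    using A B by (intro bexI[of _ "A ** B"]) (simp_all add: mult_closed matrix_vector_mul_assoc[symmetric])
qed

lemma orb_uminus:
  assumes "- v \<in> orb G v" "x \<in> orb G v"
  shows "- x \<in> orb G v"
proof -
  obtain A where A: "A \<in> G" "x = A *v v" using assms(2) by (auto simp: orb_def)
  then have "- x = A *v (- v)" by (simp add: matrix_vector_mult_uminus)
  then show ?thesis using orb_closed[OF A(1) assms(1)] by simp
qed

lemma pole_fixed_vector:
  assumes v: "v \<in> poles G" and s: "\<And>A. A \<in> stab G v \<Longrightarrow> A *v s = s"
  shows "s = (v \<bullet> s) *\<^sub>R v"
proof -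
  obtain A where A: "norm v = 1" "A \<in> G" "A \<noteq> mat 1" "A *v v = v" using v by (auto simp: poles_def)
  then show ?thesis using fixed_vector[OF rotation[OF A(2)] A(3,4,1)] s by (simp add: stab_def)
qed

lemma sum_orb_fixed:
  assumes "A \<in> G"
  shows "A *v \<Sum>(orb G x) = \<Sum>(orb G x)"
proof -
  have inj: "inj_on ((*v) A) (orb G x)" by (rule inj_onI) (metis assms inverse_mem(2))
  have "(*v) A ` orb G x = orb G x"
    using inj finite_orb[of x] orb_closed[OF assms] by (intro endo_inj_surj) auto
  then have "\<Sum>(orb G x) = (\<Sum>y\<in>orb G x. A *v y)"
    using sum.reindex[OF inj, of "\<lambda>y. y"] by simp
  also have "\<dots> = A *v \<Sum>(orb G x)"
    by (simp add: linear_sum[OF matrix_vector_mul_linear, symmetric])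
  finally show ?thesis by simp
qed

text \<open>The sum of the four vertices is invariant, hence a multiple of each vertex, hence zero.
  This forces the common inner product c to be -1/3 and expresses the fourth vertex through the
  other three.\<close>

lemma tetrahedral:
  assumes v: "v \<in> poles G" and cV: "card (orb G v) = 4" and cH: "card (stab G v) = 3"
  shows "map_group (act ` G) \<cong> map_group (rotational_symmetries regular_tetrahedron)"
proof -
  let ?V = "orb G v"
  let ?W = "?V - {v, - v}"
  have nv: "norm v = 1" using v by (simp add: poles_def)
  have nV: "norm x = 1" if "x \<in> ?V" for x using orb_norm[OF that] nv by simp
  have dv: "3 dvd card ?W" using pole_neighbours(1)[OF v] cH by simp
  have W: "- v \<notin> ?V" "card ?W = 3"
    using dv card_minus_axis[OF nv] cV by (auto split: if_splits)
  then obtain a b t where abt: "?W = {a, b, t}" "a \<noteq> b" "a \<noteq> t" "b \<noteq> t" by (auto simp: card_3_iff)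
  have aW: "a \<in> ?W" using abt by simp
  have Wa: "orb (stab G v) a = ?W"
    using pole_neighbours(2,3)[OF v aW] W(2) cH finite_orb by (intro card_subset_eq) auto
  define c where "c = v \<bullet> a"
  have pair: "x \<bullet> y = c" if xy: "x \<in> ?V" "y \<in> ?V" "x \<noteq> y" for x y
  proof -
    obtain A z where A: "x = A *v v" "y = A *v z" and z: "z \<in> ?V" "v \<bullet> z = x \<bullet> y"
      using pair_transfer[OF xy(1,2)] by metis
    then have "z \<noteq> v" using xy(3) by auto
    then have "z \<in> orb (stab G v) a" using z(1) W(1) Wa by auto
    then show ?thesis using z(2) stab_orb_inner by (simp add: c_def)
  qed
  have Vset: "?V = {v, a, b, t}" "v \<notin> {a, b, t}" using abt W(1) orb_self[of v] by auto
  have c1: "c \<noteq> 1" using unit_eq_or_minus(1)[OF nv, of a] nV[of a] Vset by (auto simp: c_def)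
  define s where "s = \<Sum>?V"
  have s: "s = v + a + b + t" unfolding s_def Vset(1) using abt(2-4) Vset(2) by simp
  have fixV: "s = (x \<bullet> s) *\<^sub>R x" if "x \<in> ?V" for x
  proof (rule pole_fixed_vector)
    show "x \<in> poles G" using that pole_orb_subset[OF v] by blast
    show "A *v s = s" if "A \<in> stab G x" for A using that sum_orb_fixed by (simp add: s_def stab_def)
  qed
  have n1: "x \<bullet> x = 1" if "x \<in> ?V" for x using nV[OF that] by (simp add: norm_eq_1)
  have vs: "v \<bullet> s = 1 + 3 * c" and as: "a \<bullet> s = 1 + 3 * c"
    using pair[of v a] pair[of v b] pair[of v t] pair[of a b] pair[of a t] n1[of v] n1[of a]
      Vset abt(2-4) by (auto simp: s inner_add_right inner_commute[of a v])
  have sv: "s = (1 + 3 * c) *\<^sub>R v" and sa: "s = (1 + 3 * c) *\<^sub>R a"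
    using fixV[OF orb_self] fixV[of a] aW unfolding vs as by blast+
  have "(1 + 3 * c) *\<^sub>R v = (1 + 3 * c) *\<^sub>R a" using sv sa by metis
  then have c: "c = - 1 / 3" using Vset(2) by (simp add: scaleR_cancel_left)
  have "s = 0" using sv c by simp
  then have "(v + a + b) + t = 0" by (simp add: s)
  then have t: "t = - (v + a + b)" using minus_unique by metis
  have ip: "v \<bullet> a = c" "v \<bullet> b = c" "a \<bullet> b = c"
    using pair Vset abt(2-4) by auto
  \<comment> \<open>The factor is the norm of the vertices (1, 1, 1), (1, -1, -1) and so on.\<close>
  have "\<exists>T. orthogonal_matrix T \<and> sqrt 3 *\<^sub>R (T *v v) = vector [1, 1, 1] \<and>
      sqrt 3 *\<^sub>R (T *v a) = vector [1, -1, -1] \<and> sqrt 3 *\<^sub>R (T *v b) = vector [-1, 1, -1]"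
    by (rule equiangular_triple(2)[OF _ _ _ ip])
      (use nV Vset c in \<open>simp_all add: inner_vec_def sum_3 vector_3 power2_eq_square power3_eq_cube\<close>)
  then obtain T where T: "orthogonal_matrix T" "sqrt 3 *\<^sub>R (T *v v) = vector [1, 1, 1]"
      "sqrt 3 *\<^sub>R (T *v a) = vector [1, -1, -1]" "sqrt 3 *\<^sub>R (T *v b) = vector [-1, 1, -1]" by blast
  have "sqrt 3 *\<^sub>R (T *v t) = - (sqrt 3 *\<^sub>R (T *v v) + sqrt 3 *\<^sub>R (T *v a) + sqrt 3 *\<^sub>R (T *v b))"
    by (simp add: t matrix_vector_mult_uminus matrix_vector_right_distrib scaleR_add_right
        matrix_vector_mult_diff_distrib scaleR_diff_right)
  also have "\<dots> = vector [-1, -1, 1]" unfolding T by (simp add: vec_eq_iff forall_3 vector_3)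
  finally have Tt: "sqrt 3 *\<^sub>R (T *v t) = vector [-1, -1, 1]" .
  show ?thesis
    unfolding regular_tetrahedron_def
  proof (rule polyhedron_iso[OF nV orb_closed])
    show "v \<in> ?V" "a \<in> ?V" using Vset by auto
    show "cross3 v a \<noteq> 0" by (rule cross3_unit_nonzero) (use nV Vset W(1) in auto)
    show "\<exists>A\<in>G. A *v v = x \<and> A *v a = y" if "x \<in> ?V" "y \<in> ?V" "x \<bullet> y = v \<bullet> a" for x y
    proof (rule flag_transitive[OF that])
      fix z assume z: "z \<in> ?V" "v \<bullet> z = v \<bullet> a"
      then have "z \<noteq> v" using n1[of v] c1 Vset(1) by (auto simp: c_def)
      then show "z \<in> orb (stab G v) a" using z(1) W(1) Wa by auto
    qed
    show "(\<lambda>x. sqrt 3 *\<^sub>R (T *v x)) ` ?V =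
      {vector [1, 1, 1], vector [1, - 1, - 1], vector [- 1, 1, - 1], vector [- 1, - 1, 1]}"
      unfolding Vset(1) by (simp add: T Tt)
  qed (use T in auto)
qed

text \<open>The four points other than v and -v are one stabilizer orbit, so they have equal height.
  They include a and -a, hence the height is 0 and the orbit consists of an orthonormal frame and
  its negatives.\<close>

lemma octahedral:
  assumes v: "v \<in> poles G" and cV: "card (orb G v) = 6" and cH: "card (stab G v) = 4"
  shows "map_group (act ` G) \<cong> map_group (rotational_symmetries regular_octahedron)"
proof -
  let ?V = "orb G v"
  let ?W = "?V - {v, - v}"
  have nv: "norm v = 1" using v by (simp add: poles_def)
  have nV: "norm x = 1" if "x \<in> ?V" for x using orb_norm[OF that] nv by simp
  have dv: "4 dvd card ?W" using pole_neighbours(1)[OF v] cH by simp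
  have W: "- v \<in> ?V" "card ?W = 4"
    using dv card_minus_axis[OF nv] cV by (auto split: if_splits)
  have neg: "- x \<in> ?V" if "x \<in> ?V" for x using orb_uminus[OF W(1) that] .
  have "?W \<noteq> {}" using W(2) by (metis card.empty zero_neq_numeral)
  then obtain a where a: "a \<in> ?W" by blast
  have Wa: "orb (stab G v) a = ?W"
    using pole_neighbours(2,3)[OF v a] W(2) cH finite_orb by (intro card_subset_eq) auto
  have va: "v \<bullet> a = 0"
  proof -
    have "- a \<in> ?W" using a neg by auto
    then have "v \<bullet> (- a) = v \<bullet> a" using Wa stab_orb_inner by blast
    then show ?thesis by simp
  qed
  have pair: "x \<bullet> y = 0" if xy: "x \<in> ?V" "y \<in> ?V" "y \<noteq> x" "y \<noteq> - x" for x y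
  proof -
    obtain A z where A: "x = A *v v" "y = A *v z" and z: "z \<in> ?V" "v \<bullet> z = x \<bullet> y"
      using pair_transfer[OF xy(1,2)] by metis
    then have "z \<in> ?W" using xy(3,4) by (auto simp: matrix_vector_mult_uminus)
    then have "z \<in> orb (stab G v) a" using Wa by simp
    then show ?thesis using z(2) stab_orb_inner va by simp
  qed
  have "\<not> ?W \<subseteq> {a, - a}"
  proof
    assume "?W \<subseteq> {a, - a}"
    then have "card ?W \<le> card {a, - a}" by (intro card_mono) auto
    also have "\<dots> \<le> 2" by (simp add: card_insert_if)
    finally show False using W(2) by simp
  qed
  then obtain b where b: "b \<in> ?W" "b \<noteq> a" "b \<noteq> - a" by auto
  have ip: "v \<bullet> a = 0" "v \<bullet> b = 0" "a \<bullet> b = 0"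
    using va pair[of v b] pair[of a b] orb_self[of v] a b by auto
  have Vset: "?V = {v, - v, a, - a, b, - b}"
  proof
    show "{v, - v, a, - a, b, - b} \<subseteq> ?V" using orb_self[of v] a b neg by auto
    show "?V \<subseteq> {v, - v, a, - a, b, - b}"
    proof
      fix x assume x: "x \<in> ?V"
      show "x \<in> {v, - v, a, - a, b, - b}"
      proof (rule ccontr)
        assume nx: "x \<notin> {v, - v, a, - a, b, - b}"
        have xs: "x \<bullet> v = 0" "x \<bullet> a = 0" "x \<bullet> b = 0"
          using pair[of v x] pair[of a x] pair[of b x] nx x orb_self[of v] a b by (auto simp: inner_commute)
        have "x = 0"
          by (rule equiangular_triple(1)[OF _ _ _ ip]) (use xs nV orb_self[of v] a b in auto)
        then show False using nV[OF x] by simp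
      qed
    qed
  qed
  have "\<exists>T. orthogonal_matrix T \<and> 1 *\<^sub>R (T *v v) = vector [1, 0, 0] \<and>
      1 *\<^sub>R (T *v a) = vector [0, 1, 0] \<and> 1 *\<^sub>R (T *v b) = vector [0, 0, 1]"
    by (rule equiangular_triple(2)[OF _ _ _ ip])
      (use nV orb_self[of v] a b in \<open>simp_all add: inner_vec_def sum_3 vector_3\<close>)
  then obtain T where T: "orthogonal_matrix T" "T *v v = vector [1, 0, 0]"
      "T *v a = vector [0, 1, 0]" "T *v b = vector [0, 0, 1]" by auto
  have vm: "- vector [x, y, z] = (vector [- x, - y, - z] :: real^3)" for x y z
    by (simp add: vec_eq_iff forall_3 vector_3)
  show ?thesis
    unfolding regular_octahedron_def
  proof (rule polyhedron_iso[OF nV orb_closed])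
    show "v \<in> ?V" "a \<in> ?V" using Vset by auto
    show "cross3 v a \<noteq> 0" by (rule cross3_unit_nonzero) (use nV a nv in auto)
    show "\<exists>A\<in>G. A *v v = x \<and> A *v a = y" if "x \<in> ?V" "y \<in> ?V" "x \<bullet> y = v \<bullet> a" for x y
    proof (rule flag_transitive[OF that])
      fix z assume z: "z \<in> ?V" "v \<bullet> z = v \<bullet> a"
      then have "z \<noteq> v" "z \<noteq> - v" using nv va by (auto simp: norm_eq_1)
      then show "z \<in> orb (stab G v) a" using z(1) Wa by auto
    qed
    show "(\<lambda>x. 1 *\<^sub>R (T *v x)) ` ?V =
      (\<Union>s\<in>{1, - 1}. {vector [s, 0, 0], vector [0, s, 0], vector [0, 0, s]})"
      unfolding Vset by (auto simp: T matrix_vector_mult_uminus vm)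
  qed (use T in auto)
qed

end

context finite_rotation_group
begin

text \<open>
  The neighbours of \<open>v\<close> form an orbit \<open>A\<close> of its stabilizer at height \<open>h\<close>, and the other points of the
  orbit are \<open>\<plusminus>v\<close> and \<open>-A\<close>. As \<open>A\<close> sums to \<open>5hv\<close>, an element \<open>a\<close> of \<open>A\<close> with \<open>p\<close> neighbours in \<open>A\<close> satisfies
  \<open>5h\<^sup>2 = 1 + (2p - 4)h\<close>. Here \<open>p\<close> is even because inversion in the stabilizer pairs off these neighbours.
  For \<open>p = 4\<close> this gives \<open>h = 1\<close>, and \<open>p = 0\<close> would make the five elements of \<open>A\<close> linearly independent, so
  \<open>h = 1 / \<surd>5\<close>.
\<close>

lemma icosahedral:
  assumes v: "v \<in> poles G" and cV: "card (orb G v) = 12" and cH: "card (stab G v) = 5"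
  shows "map_group (act ` G) \<cong> map_group (rotational_symmetries regular_icosahedron)"
proof -
  interpret H: finite_rotation_group "stab G v" by (rule finite_rotation_group_stab)
  let ?V = "orb G v"
  let ?H = "stab G v"
  let ?W = "?V - {v, - v}"
  have nv: "norm v = 1" using v by (simp add: poles_def)
  have nV: "norm x = 1" if "x \<in> ?V" for x using orb_norm[OF that] nv by simp
  have dv: "5 dvd card ?W" using pole_neighbours(1)[OF v] cH by simp
  have W: "- v \<in> ?V" "card ?W = 10"
    using dv card_minus_axis[OF nv] cV by (auto split: if_splits)
  have neg: "- x \<in> ?V" if "x \<in> ?V" for x using orb_uminus[OF W(1) that] .
  have negW: "- x \<in> ?W" if "x \<in> ?W" for x using neg that by auto
  have "?W \<noteq> {}" using W(2) by (metis card.empty zero_neq_numeral)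
  then obtain a0 where a0: "a0 \<in> ?W" by blast
  \<comment> \<open>The sign is chosen so that the height h of the neighbours is
    nonnegative.\<close>
  define a where "a = (if v \<bullet> a0 \<ge> 0 then a0 else - a0)"
  have a: "a \<in> ?W" using a0 negW[OF a0] by (simp add: a_def)
  have na: "norm a = 1" using a nV by blast
  define h where "h = v \<bullet> a"
  have h0: "h \<ge> 0" by (simp add: h_def a_def)
  define A where "A = orb ?H a"
  define B where "B = orb ?H (- a)"
  have A: "card A = 5" "A \<subseteq> ?W" "finite A"
    using pole_neighbours(2,3)[OF v a] cH H.finite_orb by (simp_all add: A_def)
  have B: "card B = 5" "B \<subseteq> ?W" "finite B"
    using pole_neighbours(2,3)[OF v negW[OF a]] cH H.finite_orb by (simp_all add: B_def)
  have aA: "a \<in> A" by (simp add: A_def H.orb_self)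
  \<comment> \<open>Otherwise negation would pair off the five points of A.\<close>
  have "- a \<notin> A"
  proof
    assume na: "- a \<in> A"
    have "even (card A)"
    proof (rule even_card_involution[where f = uminus])
      fix y assume y: "y \<in> A"
      then obtain g where g: "g \<in> ?H" "y = g *v a" by (auto simp: A_def orb_def)
      have "g *v (- a) \<in> A" using H.orb_closed[OF g(1)] na by (simp add: A_def)
      then show "- y \<in> A" by (simp add: g(2) matrix_vector_mult_uminus)
      show "- y \<noteq> y" using unit_neq_minus[of y] nV y A(2) by fastforce
    qed (use A in auto)
    then show False using A(1) by simp
  qed
  then have disj: "A \<inter> B = {}" using H.orb_eq H.orb_self unfolding A_def B_def by blast
  have AB: "?W = A \<union> B"
    using A B W(2) card_Un_disjoint[OF A(3) B(3) disj] finite_orb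
    by (intro card_subset_eq[symmetric]) auto
  have hA: "v \<bullet> y = h" if "y \<in> A" for y using stab_orb_inner that by (simp add: A_def h_def)
  have hB: "v \<bullet> y = - h" if "y \<in> B" for y using stab_orb_inner[of y v "- a"] that by (simp add: B_def h_def)
  have pair: "x \<bullet> y = h \<or> x \<bullet> y = - h"
    if xy: "x \<in> ?V" "y \<in> ?V" "y \<noteq> x" "y \<noteq> - x" for x y
  proof -
    obtain C z where C: "x = C *v v" "y = C *v z" and z: "z \<in> ?V" "v \<bullet> z = x \<bullet> y"
      using pair_transfer[OF xy(1,2)] by metis
    then have "z \<in> ?W" using xy(3,4) by (auto simp: matrix_vector_mult_uminus)
    then show ?thesis using z(2) AB hA hB by auto
  qed
  have fixed_sum: "\<Sum>A = (v \<bullet> \<Sum>A) *\<^sub>R v"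
    by (rule pole_fixed_vector[OF v]) (simp add: A_def H.sum_orb_fixed)
  have "v \<bullet> \<Sum>A = 5 * h" using hA A(1) by (simp add: inner_sum_right)
  then have "\<Sum>A = (5 * h) *\<^sub>R v" using fixed_sum by metis
  then have "a \<bullet> \<Sum>A = 5 * h * h" by (simp add: h_def inner_commute)
  moreover have "a \<bullet> \<Sum>A = 1 + (\<Sum>y\<in>A - {a}. a \<bullet> y)"
    using sum.remove[OF A(3) aA, of "\<lambda>y. a \<bullet> y"] na by (simp add: inner_sum_right norm_eq_1)
  ultimately have sum1: "5 * h * h = 1 + (\<Sum>y\<in>A - {a}. a \<bullet> y)" by simp
  have vals: "a \<bullet> y = h \<or> a \<bullet> y = - h" if "y \<in> A - {a}" for y
    using pair[of a y] that a A(2) \<open>- a \<notin> A\<close> by auto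
  define P where "P = {y \<in> A - {a}. a \<bullet> y = h}"
  have PA: "P \<subseteq> A - {a}" by (auto simp: P_def)
  have card4: "card (A - {a}) = 4" using A aA by simp
  have cP: "card P \<le> 4" using card_mono[OF _ PA] A(3) card4 by simp
  have "(\<Sum>y\<in>A - {a}. a \<bullet> y) = (\<Sum>y\<in>A - {a} - P. a \<bullet> y) + (\<Sum>y\<in>P. a \<bullet> y)"
    using sum.subset_diff[OF PA] A(3) by simp
  also have "(\<Sum>y\<in>P. a \<bullet> y) = card P * h" by (simp add: P_def)
  also have "(\<Sum>y\<in>A - {a} - P. a \<bullet> y) = (\<Sum>y\<in>A - {a} - P. - h)"
    by (rule sum.cong[OF refl]) (use vals in \<open>auto simp: P_def\<close>)
  also have "\<dots> = - ((4 - real (card P)) * h)"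
    using card_Diff_subset[OF _ PA] PA A(3) card4 cP finite_subset[OF PA] by (simp add: of_nat_diff)
  finally have quad: "5 * h * h = 1 + (2 * real (card P) - 4) * h"
    using sum1 by (simp add: algebra_simps)
  have hpos: "h > 0" using quad h0 by (cases "h = 0") auto
  have h1: "h \<noteq> 1" using unit_eq_or_minus(1)[OF nv na] a by (auto simp: h_def)
  have "even (card P)"
  proof -
    \<comment> \<open>K indexes P by stabilizer elements. It is closed under inversion because a and
      \<open>g *v a\<close> have the same inner product as a and \<open>transpose g *v a\<close>; an
      element of order 2 would pair off the five points of A.\<close>
    define K where "K = {g \<in> ?H. g \<noteq> mat 1 \<and> a \<bullet> (g *v a) = h}"
    have free: "g = mat 1" if "g \<in> ?H" "y \<in> A" "g *v y = y" for g y
      using stab_free[OF v] that A(2) by blast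
    have "bij_betw (\<lambda>g. g *v a) K P"
    proof (rule bij_betwI')
      fix g g' assume "g \<in> K" "g' \<in> K"
      then have g: "g \<in> ?H" "g' \<in> ?H" by (auto simp: K_def)
      show "(g *v a = g' *v a) = (g = g')"
      proof
        assume "g *v a = g' *v a"
        then have "(transpose g ** g') *v a = a"
          using H.inverse_mem(2)[OF g(1), of a] by (simp add: matrix_vector_mul_assoc[symmetric])
        then have "transpose g ** g' = mat 1"
          using free H.mult_closed H.transpose_closed g aA by blast
        then show "g = g'"
          using rotation_matrix_inverse(5)[OF H.rotation[OF g(1)], of g'] by simp
      qed simp
    next
      fix g assume "g \<in> K"
      then have g: "g \<in> ?H" "g \<noteq> mat 1" "a \<bullet> (g *v a) = h" by (auto simp: K_def)
      have "g *v a \<in> A" using g(1) by (auto simp: A_def orb_def)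
      moreover have "g *v a \<noteq> a" using free[OF g(1) aA] g(2) by blast
      ultimately show "g *v a \<in> P" using g(3) by (simp add: P_def)
    next
      fix y assume y: "y \<in> P"
      then obtain g where g: "g \<in> ?H" "y = g *v a" by (auto simp: P_def A_def orb_def)
      then show "\<exists>g\<in>K. y = g *v a" using y by (intro bexI[of _ g]) (auto simp: K_def P_def)
    qed
    then have "card P = card K" by (simp add: bij_betw_same_card)
    moreover have "even (card K)"
    proof (rule even_card_involution[where f = transpose])
      show "finite K" using H.finite_G by (simp add: K_def)
      fix g assume "g \<in> K"
      then have g: "g \<in> ?H" "g \<noteq> mat 1" "a \<bullet> (g *v a) = h" by (auto simp: K_def)
      have "a \<bullet> (transpose g *v a) = h" using g(3) by (metis inner_commute inner_transpose)
      moreover have "transpose g \<noteq> mat 1" using g(2) by (metis transpose_mat transpose_transpose)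
      ultimately show "transpose g \<in> K" using H.transpose_closed[OF g(1)] by (simp add: K_def)
      show "transpose (transpose g) = g" by simp
      show "transpose g \<noteq> g"
      proof
        assume gg: "transpose g = g"
        have "even (card A)"
        proof (rule even_card_involution[where f = "\<lambda>y. g *v y"])
          fix y assume y: "y \<in> A"
          show "g *v y \<in> A" using H.orb_closed[OF g(1)] y by (simp add: A_def)
          show "g *v (g *v y) = y" using H.inverse_mem(2)[OF g(1), of y] gg by simp
          show "g *v y \<noteq> y" using free[OF g(1) y] g(2) by blast
        qed (rule A(3))
        then show False using A(1) by simp
      qed
    qed
    ultimately show ?thesis by simp
  qed
  then have "card P = 0 \<or> card P = 2 \<or> card P = 4" using cP by presburger
  moreover have "card P \<noteq> 4"
  proof
    assume "card P = 4"
    then have "(h - 1) * (5 * h + 1) = 0" using quad by (simp add: algebra_simps)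
    then show False using h1 hpos by simp
  qed
  moreover have "card P \<noteq> 0"
  proof
    assume P0: "card P = 0"
    then have "P = {}" using finite_subset[OF PA] A(3) by simp
    have "(h + 1) * (5 * h - 1) = 0" using quad P0 by (simp add: algebra_simps)
    then have h5: "h = 1 / 5" using hpos by simp
    have off: "x \<bullet> y = - 1 / 5" if xy: "x \<in> A" "y \<in> A" "y \<noteq> x" for x y
    proof -
      obtain g where g: "g \<in> ?H" "x = g *v a" using xy(1) by (auto simp: A_def orb_def)
      have "transpose g *v y \<in> A" using H.orb_closed[OF H.transpose_closed[OF g(1)]] xy(2) by (simp add: A_def)
      moreover have "transpose g *v y \<noteq> a" using H.inverse_mem(1)[OF g(1), of y] xy(3) g(2) by auto
      ultimately have "a \<bullet> (transpose g *v y) = - h" using vals[of "transpose g *v y"] \<open>P = {}\<close> by (auto simp: P_def)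
      then show ?thesis using h5 g(2) by (metis inner_commute inner_transpose minus_divide_left)
    qed
    have "independent A"
    proof
      assume "dependent A"
      then obtain u where u: "\<exists>x\<in>A. u x \<noteq> 0" "(\<Sum>x\<in>A. u x *\<^sub>R x) = 0"
        using A(3) by (auto simp: real_vector.dependent_finite)
      define U where "U = (\<Sum>x\<in>A. u x)"
      \<comment> \<open>Taking the inner product of the relation with y gives u y = (U - u y) / 5.
        The coefficients are thus all equal, and summing five of them gives U = 5U/6.\<close>
      have uy: "u y = U / 6" if y: "y \<in> A" for y
      proof -
        have "0 = y \<bullet> (\<Sum>x\<in>A. u x *\<^sub>R x)" by (simp add: u(2))
        also have "\<dots> = (\<Sum>x\<in>A. u x * (y \<bullet> x))" by (simp add: inner_sum_right)
        also have "\<dots> = u y * (y \<bullet> y) + (\<Sum>x\<in>A - {y}. u x * (y \<bullet> x))"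
          by (rule sum.remove[OF A(3) y])
        also have "(\<Sum>x\<in>A - {y}. u x * (y \<bullet> x)) = (\<Sum>x\<in>A - {y}. u x * (- 1 / 5))"
          by (rule sum.cong[OF refl]) (use off y in auto)
        also have "\<dots> = (U - u y) * (- 1 / 5)"
          unfolding U_def sum_distrib_right[symmetric] using sum.remove[OF A(3) y, of u] by simp
        also have "y \<bullet> y = 1" using nV[of y] y A(2) by (auto simp: norm_eq_1)
        finally show ?thesis by (simp add: field_simps)
      qed
      have "(\<Sum>x\<in>A. u x) = (\<Sum>x\<in>A. U / 6)" using uy by (rule sum.cong[OF refl])
      then have "U = 5 * (U / 6)" using A(1) by (simp add: U_def[symmetric])
      then have "U = 0" by simp
      then show False using uy u(1) by auto
    qed
    then show False using independent_bound[of A] A(1) by simp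
  qed
  ultimately have P2: "card P = 2" by blast
  then have hh: "5 * h * h = 1" using quad by simp
  define r where "r = sqrt 5"
  have r: "r * r = 5" "r > 0" by (simp_all add: r_def)
  have hr: "h = r / 5"
  proof -
    have "(5 * h - r) * (5 * h + r) = 0" using hh r(1) by (simp add: algebra_simps)
    then show ?thesis using hpos r(2) by simp
  qed
  have "P \<noteq> {}" using P2 by auto
  then obtain w where w: "w \<in> A" "w \<noteq> a" "a \<bullet> w = h" by (auto simp: P_def)
  have ip: "v \<bullet> a = h" "v \<bullet> w = h" "a \<bullet> w = h" using w hA by (auto simp: h_def)
  have ip': "a \<bullet> v = h" "w \<bullet> v = h" "w \<bullet> a = h" using ip by (simp_all add: inner_commute)
  have mem: "v \<in> ?V" "a \<in> ?V" "w \<in> ?V" using orb_self a w A(2) by auto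
  have nn: "norm v = 1" "norm a = 1" "norm w = 1" using mem nV by auto
  have nn': "v \<bullet> v = 1" "a \<bullet> a = 1" "w \<bullet> w = 1" using nn by (simp_all add: norm_eq_1)
  have "h ^ 3 = r / 25" "h\<^sup>2 = 1 / 5"
    using r(1) by (simp_all add: hr power2_eq_square power3_eq_cube field_simps)
  then have nz: "1 + 2 * h ^ 3 - 3 * h\<^sup>2 \<noteq> 0" using r(2) by simp
  note triple = equiangular_triple[OF nn ip nz]
  \<comment> \<open>This is 2h / (1 + h), the inverse of the golden ratio. With it, q1 is the image
    of w under the half-turn about the midpoint of the edge from v to a; q2 and q3 arise likewise
    from the other two edges of the triangle v, a, w.\<close>
  define k where "k = (r - 1) / 2"
  have k: "k * (1 + h) - h = h" "2 * h * k - 1 = - h"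
    using r(1) by (simp_all add: k_def hr field_simps)
  define q1 q2 q3 where "q1 = k *\<^sub>R (v + a) - w" and "q2 = k *\<^sub>R (v + w) - a" and "q3 = k *\<^sub>R (a + w) - v"
  have kk: "k * (1 + h) - h = h" "k * (h + 1) - h = h" "k * (h + h) - 1 = - h"
    using k by (simp_all add: algebra_simps)
  have q: "q1 \<bullet> v = h" "q1 \<bullet> a = h" "q1 \<bullet> w = - h" "q2 \<bullet> v = h" "q2 \<bullet> a = - h" "q2 \<bullet> w = h"
    "q3 \<bullet> v = - h" "q3 \<bullet> a = h" "q3 \<bullet> w = h"
    by (simp_all only: q1_def q2_def q3_def inner_diff_left inner_scaleR_left inner_add_left ip ip' nn' kk)
  \<comment> \<open>A list of twelve candidates: the bound by its length, together with 12 points in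
    the orbit, later gives equality without checking that the candidates are distinct.\<close>
  define E where "E = set [v, - v, a, - a, w, - w, q1, - q1, q2, - q2, q3, - q3]"
  have EI: "x \<in> E" if x: "x \<in> ?V" "x \<bullet> v = h" "x \<noteq> a" "x \<noteq> - a" "x \<noteq> w" "x \<noteq> - w" for x
  proof -
    have eq: "x = y" if "y \<bullet> v = x \<bullet> v" "y \<bullet> a = x \<bullet> a" "y \<bullet> w = x \<bullet> w" for y
      using triple(1)[of "x - y"] that by (simp add: inner_diff_left)
    have "x \<bullet> a = h \<or> x \<bullet> a = - h" "x \<bullet> w = h \<or> x \<bullet> w = - h"
      using pair[of a x] pair[of w x] mem x by (auto simp: inner_commute)
    moreover have "\<not> (x \<bullet> a = h \<and> x \<bullet> w = h)"
    proof
      assume *: "x \<bullet> a = h \<and> x \<bullet> w = h"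
      \<comment> \<open>A point at inner product h with all three vertices would be this multiple of
        v + a + w; unit length would then require 1 + 2h = 3h^2 = 3/5.\<close>
      define m where "m = h / (1 + 2 * h)"
      have m: "m * (1 + 2 * h) = h" using hpos by (simp add: m_def)
      have "x = m *\<^sub>R (v + a + w)"
        by (rule eq) (use * x(2) m in \<open>simp_all add: inner_add_left ip ip' nn' algebra_simps\<close>)
      then have "x \<bullet> x = m * (x \<bullet> v + x \<bullet> a + x \<bullet> w)"
        by (metis inner_add_right inner_scaleR_right)
      then have "1 = m * (3 * h)" using nV[OF x(1)] * x(2) by (simp add: norm_eq_1)
      then have "1 + 2 * h = m * (1 + 2 * h) * (3 * h)" by (simp add: algebra_simps)
      then have "1 + 2 * h = 3 * h * h" unfolding m by simp
      then show False using hh hpos by simp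
    qed
    ultimately consider "x \<bullet> a = h" "x \<bullet> w = - h" | "x \<bullet> a = - h" "x \<bullet> w = h" | "x \<bullet> a = - h" "x \<bullet> w = - h"
      by blast
    then show ?thesis
    proof cases
      case 1
      then have "x = q1" by (intro eq) (simp_all add: q x(2))
      then show ?thesis by (simp add: E_def)
    next
      case 2
      then have "x = q2" by (intro eq) (simp_all add: q x(2))
      then show ?thesis by (simp add: E_def)
    next
      case 3
      then have "x = - q3" by (intro eq) (simp_all add: q x(2))
      then show ?thesis by (simp add: E_def)
    qed
  qed
  have negE: "x \<in> E" if "- x \<in> E" for x
    using that by (auto simp: E_def minus_equation_iff[of x])
  have "?V \<subseteq> E"
  proof
    fix x assume x: "x \<in> ?V"
    show "x \<in> E"
    proof (cases "x \<in> {v, - v, a, - a, w, - w}")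
      case False
      then have "x \<bullet> v = h \<or> x \<bullet> v = - h" using pair[of v x] mem x by (auto simp: inner_commute)
      then show ?thesis
      proof
        assume "x \<bullet> v = - h"
        then have "- x \<in> E" using False neg[OF x] by (intro EI) (auto simp: minus_equation_iff[of x])
        then show ?thesis by (rule negE)
      qed (use False EI x in auto)
    qed (auto simp: E_def)
  qed
  moreover have "card E \<le> card ?V"
    unfolding cV E_def by (rule order_trans[OF card_length]) simp
  moreover have "finite E" by (simp add: E_def)
  ultimately have VE: "?V = E" by (metis card_seteq)
  define \<phi> where "\<phi> = (1 + sqrt 5) / 2"
  have \<phi>: "\<phi> = (1 + r) / 2" by (simp add: \<phi>_def r_def)
  \<comment> \<open>The norm of the standard vertex (0, 1, \<phi>). Since \<phi>^2 = \<phi> + 1, its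
    square is 2 + \<phi>, and adjacent standard vertices have inner product \<phi> = h (2 +
    \<phi>).\<close>
  define \<rho> where "\<rho> = sqrt (1 + \<phi>\<^sup>2)"
  have \<rho>2: "\<rho>\<^sup>2 = 1 + \<phi>\<^sup>2" by (simp add: \<rho>_def add_nonneg_nonneg)
  have \<phi>2: "\<phi>\<^sup>2 = \<phi> + 1" using r(1) by (simp add: \<phi> power2_eq_square field_simps)
  have h\<phi>: "h * (2 + \<phi>) = \<phi>" using r(1) by (simp add: \<phi> hr field_simps)
  have \<rho>0: "\<rho> > 0" unfolding \<rho>_def by (simp add: add_pos_nonneg)
  have "\<exists>T. orthogonal_matrix T \<and> \<rho> *\<^sub>R (T *v v) = vector [0, 1, \<phi>] \<and>
      \<rho> *\<^sub>R (T *v a) = vector [0, -1, \<phi>] \<and> \<rho> *\<^sub>R (T *v w) = vector [\<phi>, 0, 1]"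
    by (rule triple(2)[OF \<rho>0])
      (use h\<phi> \<phi>2 in \<open>simp_all add: \<rho>2 inner_vec_def sum_3 vector_3 power2_eq_square[symmetric]\<close>)
  then obtain T where T: "orthogonal_matrix T" "\<rho> *\<^sub>R (T *v v) = vector [0, 1, \<phi>]"
      "\<rho> *\<^sub>R (T *v a) = vector [0, -1, \<phi>]" "\<rho> *\<^sub>R (T *v w) = vector [\<phi>, 0, 1]" by blast
  define L where "L x = \<rho> *\<^sub>R (T *v x)" for x
  have Lneg: "L (- x) = - L x" for x by (simp add: L_def matrix_vector_mult_uminus)
  have Lq: "L (k *\<^sub>R (x + y) - z) = k *\<^sub>R (L x + L y) - L z" for x y z
    by (simp add: L_def matrix_vector_mult_diff_distrib matrix_vector_right_distrib
        matrix_vector_mult_scaleR algebra_simps)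
  have LT: "L v = vector [0, 1, \<phi>]" "L a = vector [0, -1, \<phi>]" "L w = vector [\<phi>, 0, 1]"
    using T by (simp_all add: L_def)
  have k\<phi>: "k * \<phi> = 1" "k + 1 = \<phi>" "k * (\<phi> + 1) = \<phi>" using r(1) by (simp_all add: k_def \<phi> field_simps)
  have Lq': "L q1 = vector [- \<phi>, 0, 1]" "L q2 = vector [1, \<phi>, 0]" "L q3 = vector [1, - \<phi>, 0]"
    unfolding q1_def q2_def q3_def Lq LT
    using k\<phi> by (simp_all add: vec_eq_iff forall_3 vector_3 algebra_simps)
  have vm: "- vector [x, y, z] = (vector [- x, - y, - z] :: real^3)" for x y z
    by (simp add: vec_eq_iff forall_3 vector_3)
  show ?thesis
    unfolding regular_icosahedron_def Let_def \<phi>_def[symmetric]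
  proof (rule polyhedron_iso[OF nV orb_closed])
    show "v \<in> ?V" "a \<in> ?V" using mem by auto
    show "cross3 v a \<noteq> 0" by (rule cross3_unit_nonzero) (use nn a in auto)
    show "\<exists>A\<in>G. A *v v = x \<and> A *v a = y" if "x \<in> ?V" "y \<in> ?V" "x \<bullet> y = v \<bullet> a" for x y
    proof (rule flag_transitive[OF that])
      fix z assume z: "z \<in> ?V" "v \<bullet> z = v \<bullet> a"
      then have "z \<noteq> v" "z \<noteq> - v" using nn' h1 hpos ip by auto
      then have "z \<in> ?W" using z(1) by auto
      moreover have "z \<notin> B" using hB[of z] z(2) ip hpos by auto
      ultimately show "z \<in> orb ?H a" using AB by (auto simp: A_def)
    qed
    have "L ` ?V = (\<Union>s\<in>{1, - 1}. \<Union>t\<in>{\<phi>, - \<phi>}. {vector [0, s, t], vector [s, t, 0], vector [t, 0, s]})"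
      unfolding VE E_def by (auto simp: Lneg LT Lq' vm)
    then show "(\<lambda>x. \<rho> *\<^sub>R (T *v x)) ` ?V =
      (\<Union>s\<in>{1, - 1}. \<Union>t\<in>{\<phi>, - \<phi>}. {vector [0, s, t], vector [s, t, 0], vector [t, 0, s]})"
      by (simp add: L_def[abs_def])
  qed (use T \<rho>0 in auto)
qed

text \<open>A nontrivial rotation B about v permutes an orbit of at most two points and fixes v, so
  it fixes \<open>A *v v\<close> too; but its only fixed unit vectors are v and -v.\<close>

lemma small_orbit_axis:
  assumes v: "v \<in> poles G" and c: "card (orb G v) \<le> 2" and A: "A \<in> G"
  shows "A *v v = v \<or> A *v v = - v"
proof (rule ccontr)
  assume not: "\<not> ?thesis"
  have Av: "A *v v \<in> orb G v" using A by (simp add: orb_def)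
  obtain B where B: "norm v = 1" "B \<in> G" "B \<noteq> mat 1" "B *v v = v" using v by (auto simp: poles_def)
  have sub: "{v, A *v v} \<subseteq> orb G v" using Av orb_self by simp
  have "v \<noteq> A *v v" using not by metis
  then have "card {v, A *v v} = 2" by simp
  then have orb: "orb G v = {v, A *v v}"
    using c card_seteq[OF finite_orb sub] by simp
  have "B *v (A *v v) \<noteq> v"
  proof
    assume "B *v (A *v v) = v"
    then have "A *v v = v" using inverse_mem(2)[OF B(2)] B(4) by metis
    then show False using not by simp
  qed
  then have "B *v (A *v v) = A *v v" using orb_closed[OF B(2) Av] orb by auto
  then have "B = mat 1"
    using rotation_matrix_two_fixed[OF rotation[OF B(2)] B(4) _ B(1)] not by (simp add: norm_mem A B(1))
  then show False using B(3) by simp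
qed

lemma finite_cases:
  "(\<exists>k::int. map_group (act ` G) \<cong> map_group (roots_of_unity_maps k)) \<or>
   (\<exists>k::nat. k \<ge> 1 \<and> map_group (act ` G) \<cong> map_group (dihedral_maps k)) \<or>
   map_group (act ` G) \<cong> map_group O1_O2_maps \<or>
   map_group (act ` G) \<cong> map_group (rotational_symmetries regular_tetrahedron) \<or>
   map_group (act ` G) \<cong> map_group (rotational_symmetries regular_octahedron) \<or>
   map_group (act ` G) \<cong> map_group (rotational_symmetries regular_icosahedron)"
proof (cases "G = {mat 1}")
  \<comment> \<open>The trivial group has no poles, but it preserves every axis.\<close>
  case True
  then show ?thesis using axial_cases by auto
next
  case False
  then obtain v where v: "v \<in> poles G"
    and types: "card (orb G v) \<le> 2 \<or> (card (orb G v), card (stab G v)) \<in> {(4, 3), (6, 4), (12, 5)}"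
    by (rule pole_types)
  show ?thesis
  proof (cases "card (orb G v) \<le> 2")
    case True
    have "norm v = 1" using v by (simp add: poles_def)
    then obtain C where C: "rotation_matrix C" "C *v e3 = v" by (rule rotation_to_axis)
    interpret C: rotation_group "conj_group C G" by (rule rotation_group_conj[OF C(1)])
    have Cv: "transpose C *v v = e3" using rotation_matrix_inverse(4)[OF C(1), of e3] C(2) by simp
    have "B *v e3 = e3 \<or> B *v e3 = - e3" if B: "B \<in> conj_group C G" for B
    proof -
      obtain A where A: "A \<in> G" "B = transpose C ** A ** C" using B by (auto simp: conj_group_def)
      then show ?thesis
        using small_orbit_axis[OF v True A(1)] Cv
        by (auto simp: matrix_vector_mul_assoc[symmetric] C(2) matrix_vector_mult_uminus)
    qed
    moreover have "finite (conj_group C G)" by (simp add: conj_group_def finite_G)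
    ultimately show ?thesis
      using C.axial_cases iso_trans[OF map_group_conj[OF C(1)]] by meson
  next
    case False
    then show ?thesis using types tetrahedral[OF v] octahedral[OF v] icosahedral[OF v] by auto
  qed
qed

end

section \<open>Symmetries of a closed set and the conclusion\<close>

lemma closed_julia_set: "closed (julia_set R)"
proof -
  have "open (fatou_set R)"
    unfolding open_subopen[of "fatou_set R"] by (auto simp: fatou_set_def)
  then show ?thesis by (simp add: julia_set_def closed_def)
qed

text \<open>Equality of the image with K is restated as two pointwise inclusions, for A and for its
  inverse. Each of them passes to limits of matrices because K is closed and \<open>ster\<close>
  preserves distances.\<close>

lemma closed_rotation_stabilizer:
  assumes K: "closed K"
  shows "closed {A. rotation_matrix A \<and> act A ` K = K}"
proof -
  have iff: "act A ` K = K \<longleftrightarrow> (\<forall>x\<in>K. act A x \<in> K \<and> act (transpose A) x \<in> K)"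
    if A: "rotation_matrix A" for A
  proof
    assume K: "act A ` K = K"
    show "\<forall>x\<in>K. act A x \<in> K \<and> act (transpose A) x \<in> K"
    proof
      fix x assume x: "x \<in> K"
      then obtain y where "y \<in> K" "x = act A y" using K by blast
      then show "act A x \<in> K \<and> act (transpose A) x \<in> K" using x K by (auto simp: act_transpose A)
    qed
  next
    assume *: "\<forall>x\<in>K. act A x \<in> K \<and> act (transpose A) x \<in> K"
    show "act A ` K = K"
    proof (intro equalityI subsetI)
      fix x assume x: "x \<in> K"
      then show "x \<in> act A ` K" using * act_transpose(1)[OF A, of x] by (metis image_eqI)
    qed (use * in auto)
  qed
  have lim: "act L x \<in> K"
    if X: "\<And>n. rotation_matrix (X n)" "X \<longlonglongrightarrow> L" "rotation_matrix L" "\<And>n. act (X n) x \<in> K" for X L x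
  proof (rule closed_sequentially[OF K X(4)])
    have "(\<lambda>n. dist (X n *v ster x) (L *v ster x)) \<longlonglongrightarrow> 0"
      by (subst tendsto_dist_iff[symmetric]) (intro tendsto_intros X)
    then show "(\<lambda>n. act (X n) x) \<longlonglongrightarrow> act L x"
      by (subst tendsto_dist_iff) (simp add: dist_ster[symmetric] ster_act X)
  qed
  show ?thesis
    unfolding closed_sequential_limits
  proof (intro allI impI, elim conjE)
    fix X L assume X: "\<forall>n. X n \<in> {A. rotation_matrix A \<and> act A ` K = K}" and L: "X \<longlonglongrightarrow> L"
    have rX: "rotation_matrix (X n)" for n using X by simp
    have rL: "rotation_matrix L"
      using closed_sequentially[OF compact_imp_closed[OF compact_rotations] _ L] rX by simp
    have XK: "act (X n) x \<in> K" "act (transpose (X n)) x \<in> K" if "x \<in> K" for n x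
      using X iff[OF rX] that by auto
    have "act L x \<in> K" "act (transpose L) x \<in> K" if x: "x \<in> K" for x
      using lim[OF rX L rL XK(1)[OF x]]
        lim[OF rotation_matrix_transpose[OF rX] tendsto_matrix_transpose[OF L]
          rotation_matrix_transpose[OF rL] XK(2)[OF x]] by blast+
    then show "L \<in> {A. rotation_matrix A \<and> act A ` K = K}" using rL iff[OF rL] by simp
  qed
qed

lemma rotation_group_stabilizer: "rotation_group {A. rotation_matrix A \<and> act A ` K = K}"
proof
  show "mat 1 \<in> {A. rotation_matrix A \<and> act A ` K = K}"
    by (simp add: rotation_matrix_mat_1 act_mat_1)
  show "A ** B \<in> {A. rotation_matrix A \<and> act A ` K = K}"
    if "A \<in> {A. rotation_matrix A \<and> act A ` K = K}" "B \<in> {A. rotation_matrix A \<and> act A ` K = K}" for A B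
  proof -
    have "act (A ** B) = act A \<circ> act B" using that by (simp add: act_mult)
    then have "act (A ** B) ` K = act A ` (act B ` K)" by (simp only: image_comp)
    then show ?thesis using that by (simp add: rotation_matrix_mult)
  qed
  show "transpose A \<in> {A. rotation_matrix A \<and> act A ` K = K}"
    if "A \<in> {A. rotation_matrix A \<and> act A ` K = K}" for A
  proof -
    have A: "rotation_matrix A" "act A ` K = K" using that by auto
    have "act (transpose A) ` (act A ` K) = K" by (simp add: image_image act_transpose A(1))
    then show ?thesis using A by (simp add: rotation_matrix_transpose)
  qed
qed simp

theorem theorem2p2:
  fixes R :: "riemann_sphere \<Rightarrow> riemann_sphere" and d :: nat
  assumes "rational_map_of_degree R d" and "d \<ge> 2"
  shows
    "map_group (julia_symmetries R) \<cong> map_group {id :: riemann_sphere \<Rightarrow> riemann_sphere} \<or>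
     (\<exists>k::int. map_group (julia_symmetries R) \<cong> map_group (roots_of_unity_maps k)) \<or>
     (\<exists>k::nat. k \<ge> 1 \<and> map_group (julia_symmetries R) \<cong> map_group (dihedral_maps k)) \<or>
     map_group (julia_symmetries R) \<cong> map_group (rotational_symmetries regular_tetrahedron) \<or>
     map_group (julia_symmetries R) \<cong> map_group (rotational_symmetries regular_octahedron) \<or>
     map_group (julia_symmetries R) \<cong> map_group (rotational_symmetries regular_icosahedron) \<or>
     map_group (julia_symmetries R) \<cong> map_group O1_O2_maps \<or>
     map_group (julia_symmetries R) \<cong> map_group sphere_isometries"
proof -
  define G where "G = {A. rotation_matrix A \<and> act A ` julia_set R = julia_set R}"
  interpret rotation_group G unfolding G_def by (rule rotation_group_stabilizer)
  have sym: "julia_symmetries R = act ` G"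
    by (auto simp: julia_symmetries_def sphere_isometries_eq G_def)
  show ?thesis
  proof (cases "finite G")
    case True
    then interpret finite_rotation_group G by unfold_locales
    show ?thesis unfolding sym using finite_cases by blast
  next
    case False
    have "closed G" unfolding G_def by (rule closed_rotation_stabilizer[OF closed_julia_set])
    then show ?thesis unfolding sym using infinite_cases False by blast
  qed
qed

end
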